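(* Let $\mathbb{B}=\{z\in\mathbb{C}^n:|z|^2<1\}$ and suppose that $\gamma>0$. For every $\eta_1,\eta_2,\dots,\eta_n\in A^2_\gamma(\mathbb{B})$ such that $\partial\eta_j/\partial z^k=\partial\eta_k/\partial z^j$ for every pair $j,k=1,2,\dots,n$, there exists $f\in A^2_\gamma(\mathbb{B})$ such that $\partial f/\partial z^k=\eta_k$ for every $k=1,2,\dots,n$, and $$\int_{\mathbb{B}}|f|^2(1-|z|^2)^{\gamma-1}\,d\lambda\leqslant\frac1\gamma\int_{\mathbb{B}}\sum_{k=1}^n|\eta_k|^2(1-|z|^2)^\gamma\,d\lambda.$$ The constant $\gamma^{-1}$ on the right-hand side of this inequality is sharp. The equality occurs if and only if the $\eta_k$'s are constants.
   Context: $d\lambda$ is (a constant multiple of) the standard Lebesgue measure on $\mathbb{C}^n$. For $\gamma>-1$, $A^2_\gamma(\mathbb{B})=\{f\in\mathcal{O}(\mathbb{B}):\int_{\mathbb{B}}|f|^2(1-|z|^2)^\gamma\,d\lambda<\infty\}$, where $\mathcal{O}(\mathbb{B})$ is the space of holomorphic functions on $\mathbb{B}$. *)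

theory Defs
  imports "HOL-Analysis.Analysis"
begin

text \<open>
  Points of \<open>\<complex>\<^sup>n\<close> have type \<open>complex ^ 'n\<close>, where the index type \<open>'n\<close> plays the role of
  \<open>{1, \<dots>, n}\<close>; \<open>norm\<close> is the Hermitian norm, so the unit ball of \<open>\<complex>\<^sup>n\<close> is \<open>ball 0 1\<close>.
\<close>

text \<open>
  The library's \<open>holomorphic_on\<close> is restricted to one variable.  A function on an open subset of
  \<open>\<complex>\<^sup>n\<close> is holomorphic if it is complex differentiable at every point, i.e. its (real) Frechet
  derivative exists and is complex linear.  (Additivity of \<open>D\<close> is part of \<open>has_derivative\<close>.)
\<close>

definition holomorphic_Cn :: "(complex ^ 'n \<Rightarrow> complex) \<Rightarrow> (complex ^ 'n) set \<Rightarrow> bool" where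
  "holomorphic_Cn f S \<longleftrightarrow>
     (\<forall>z\<in>S. \<exists>D. (f has_derivative D) (at z) \<and> (\<forall>c h. D (c *s h) = c * D h))"

definition partial_deriv :: "'n \<Rightarrow> (complex ^ 'n \<Rightarrow> complex) \<Rightarrow> complex ^ 'n \<Rightarrow> complex" where
  "partial_deriv k f z = deriv (\<lambda>w. f (z + axis k w)) 0"

text \<open>
  The integral of \<open>u (1 - |z|\<^sup>2)\<^sup>\<alpha>\<close> over the unit ball, for \<open>u \<ge> 0\<close>.  It takes values in
  \<open>[0, \<infinity>]\<close>, so a divergent integral is \<open>\<infinity>\<close>.
\<close>

definition weighted_integral :: "real \<Rightarrow> (complex ^ 'n \<Rightarrow> real) \<Rightarrow> ennreal" where
  "weighted_integral \<alpha> u =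
     (\<integral>\<^sup>+ z \<in> ball 0 1. ennreal (u z * (1 - (norm z)\<^sup>2) powr \<alpha>) \<partial>lborel)"

definition bergman_space :: "real \<Rightarrow> (complex ^ 'n \<Rightarrow> complex) set" where
  "bergman_space \<gamma> =
     {f. holomorphic_Cn f (ball 0 1) \<and> weighted_integral \<gamma> (\<lambda>z. (cmod (f z))\<^sup>2) < \<infinity>}"

text \<open>The holomorphic 1-form \<open>\<Sum>k. \<eta> k dz\<^sup>k\<close> has coefficients in the Bergman space and is closed.\<close>

definition closed_bergman_form :: "real \<Rightarrow> ('n \<Rightarrow> complex ^ 'n \<Rightarrow> complex) \<Rightarrow> bool" where
  "closed_bergman_form \<gamma> \<eta> \<longleftrightarrow>
     (\<forall>k. \<eta> k \<in> bergman_space \<gamma>) \<and>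
     (\<forall>j k. \<forall>z \<in> ball 0 1. partial_deriv k (\<eta> j) z = partial_deriv j (\<eta> k) z)"

definition bergman_primitives ::
    "real \<Rightarrow> ('n \<Rightarrow> complex ^ 'n \<Rightarrow> complex) \<Rightarrow> (complex ^ 'n \<Rightarrow> complex) set" where
  "bergman_primitives \<gamma> \<eta> =
     {f \<in> bergman_space \<gamma>. \<forall>k. \<forall>z \<in> ball 0 1. partial_deriv k f z = \<eta> k z}"

end

theory Submission
  imports Defs "HOL-Complex_Analysis.Complex_Analysis"
begin

text \<open>
  Let \<open>\<rho> = 1 - |z|\<^sup>2\<close> and let \<open>f\<close> be the primitive of \<open>\<eta>\<close> with \<open>f 0 = 0\<close>, obtained by integrating \<open>\<eta>\<close>
  along rays.  Since \<open>\<eta> k\<close> is the \<open>k\<close>-th partial derivative of \<open>f\<close> and is holomorphic, integrating by parts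
  against the weight \<open>\<rho>\<^sup>\<gamma> - (1 - r\<^sup>2)\<^sup>\<gamma>\<close>, which vanishes on the sphere of radius \<open>r\<close>, gives
  \[\int_{|z|<r} \sum_k |\eta_k|^2 (\rho^\gamma - (1-r^2)^\gamma)
     = \gamma \int_{|z|<r} \mathrm{Re}(\bar f\, Rf)\, \rho^{\gamma-1},
     \qquad R = \sum_k z_k \partial_k.\]
  On a circle \<open>{e\<^sup>i\<^sup>\<theta> z}\<close>, with \<open>a\<^sub>m\<close> the Taylor coefficients of \<open>w \<mapsto> f (w z)\<close>, Parseval turns the means of
  \<open>Re (cnj f Rf)\<close> and \<open>|f|\<^sup>2\<close> into \<open>\<Sum> m |a\<^sub>m|\<^sup>2\<close> and \<open>\<Sum> |a\<^sub>m|\<^sup>2\<close>.  As \<open>a\<^sub>0 = 0\<close>, the former dominates the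
  latter, with equality only if \<open>f (w z) = w f z\<close>.  By rotation invariance of Lebesgue measure the
  inequality follows upon letting \<open>r \<rightarrow> 1\<close>; equality forces \<open>f\<close> to be homogeneous of degree \<open>1\<close>, so
  that each \<open>\<eta> k\<close> is homogeneous of degree \<open>0\<close> and hence constant.  Any other primitive is \<open>f + c\<close>, and
  \<open>c\<close> is orthogonal to \<open>f\<close> on circles, so \<open>f\<close> is minimal and constant forms show sharpness.
\<close>

section \<open>Averaging over circles\<close>

lemma nn_integral_lborel_translate:
  fixes a :: "'a::euclidean_space"
  assumes [measurable]: "g \<in> borel_measurable borel"
  shows "(\<integral>\<^sup>+x. g (a + x) \<partial>lborel) = (\<integral>\<^sup>+x. g x \<partial>lborel)"
proof -
  have "(\<integral>\<^sup>+x. g x \<partial>lborel) = (\<integral>\<^sup>+x. g x \<partial>distr lborel borel ((+) a))"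
    by (simp add: lborel_distr_plus)
  also have "\<dots> = (\<integral>\<^sup>+x. g (a + x) \<partial>lborel)"
    by (subst nn_integral_distr) auto
  finally show ?thesis ..
qed

text \<open>
  Two translation-invariant measures \<open>\<mu>\<close>, \<open>\<lambda>\<close> are proportional: evaluate
  \<open>\<integral>\<integral> 1\<^sub>A(x) 1\<^sub>B(y - x) d\<lambda>(y) d\<mu>(x)\<close> in both orders.  With \<open>B\<close> the unit ball, which an isometry
  preserves, the factor is \<open>1\<close>.
\<close>

lemma lborel_distr_isometry:
  fixes T T' :: "'a::euclidean_space \<Rightarrow> 'a"
  assumes T: "linear T" and iso: "\<And>x. norm (T x) = norm x" and inv: "\<And>x. T (T' x) = x"
  shows "distr lborel borel T = lborel"
proof (rule measure_eqI)
  let ?b = "\<lambda>x::'a. indicator (ball 0 1) x :: ennreal"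
  have [measurable]: "T \<in> borel_measurable borel"
    using T by (intro borel_measurable_continuous_onI linear_continuous_on) (simp add: linear_linear)
  have b[measurable, simp]: "indicator (ball (0::'a) 1) \<in> borel_measurable borel"
    by (rule borel_measurable_indicator) simp
  have Tadd: "T (x + y) = T x + T y" for x y
    using T by (simp add: linear_add)
  show "sets (distr lborel borel T) = sets (lborel :: 'a measure)" by simp
  fix A assume "A \<in> sets (distr lborel borel T)"
  then have A[measurable]: "A \<in> sets borel" by simp
  let ?A = "\<lambda>x::'a. indicator A x :: ennreal"
  let ?c = "emeasure lborel (ball (0::'a) 1)"
  \<comment> \<open>The image of Lebesgue measure under \<open>T\<close> is translation invariant:
    shifting the argument by \<open>T' y\<close> shifts the value of \<open>T\<close> by
    \<open>y\<close>.\<close>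
  have trans: "(\<integral>\<^sup>+x. g (T x) \<partial>lborel) = (\<integral>\<^sup>+x. g (T x + y) \<partial>lborel)"
    if [measurable]: "g \<in> borel_measurable borel" for g :: "'a \<Rightarrow> ennreal" and y
  proof -
    have "(\<integral>\<^sup>+x. g (T x) \<partial>lborel) = (\<integral>\<^sup>+x. g (T (T' y + x)) \<partial>lborel)"
      by (intro nn_integral_lborel_translate[symmetric]) measurable
    then show ?thesis by (simp add: Tadd inv add.commute)
  qed
  have "emeasure (distr lborel borel T) A * ?c = (\<integral>\<^sup>+x. ?A (T x) \<partial>lborel) * (\<integral>\<^sup>+y. ?b y \<partial>lborel)"
    by (subst nn_integral_distr[symmetric, of T lborel borel]) auto
  also have "\<dots> = (\<integral>\<^sup>+x. ?A (T x) * (\<integral>\<^sup>+y. ?b y \<partial>lborel) \<partial>lborel)"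
    by (rule nn_integral_multc[symmetric]) measurable
  also have "\<dots> = (\<integral>\<^sup>+x. ?A (T x) * (\<integral>\<^sup>+y. ?b (- T x + y) \<partial>lborel) \<partial>lborel)"
    by (subst nn_integral_lborel_translate) auto
  also have "\<dots> = (\<integral>\<^sup>+x. (\<integral>\<^sup>+y. ?A (T x) * ?b (- T x + y) \<partial>lborel) \<partial>lborel)"
    by (subst nn_integral_cmult[symmetric]) auto
  also have "\<dots> = (\<integral>\<^sup>+y. (\<integral>\<^sup>+x. ?A (T x) * ?b (- T x + y) \<partial>lborel) \<partial>lborel)"
    by (rule lborel_pair.Fubini'[symmetric]) measurable
  also have "\<dots> = (\<integral>\<^sup>+y. (\<integral>\<^sup>+x. ?A (T x + y) * ?b (- T x) \<partial>lborel) \<partial>lborel)"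
    using trans[of "\<lambda>u. ?A u * ?b (- u + y)" y for y] by - (rule nn_integral_cong, simp)
  also have "\<dots> = (\<integral>\<^sup>+x. (\<integral>\<^sup>+y. ?A (T x + y) * ?b (- T x) \<partial>lborel) \<partial>lborel)"
    by (rule lborel_pair.Fubini') measurable
  also have "\<dots> = (\<integral>\<^sup>+x. (\<integral>\<^sup>+y. ?A (T x + y) \<partial>lborel) * ?b (- T x) \<partial>lborel)"
    by (subst nn_integral_multc[symmetric]) auto
  also have "\<dots> = (\<integral>\<^sup>+x. (\<integral>\<^sup>+y. ?A y \<partial>lborel) * ?b x \<partial>lborel)"
    by (subst nn_integral_lborel_translate) (auto simp: iso indicator_def)
  also have "\<dots> = emeasure lborel A * ?c"
    by (subst nn_integral_cmult) auto
  finally have "?c * emeasure (distr lborel borel T) A = ?c * emeasure lborel A"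
    by (simp add: mult.commute)
  moreover have "?c \<noteq> 0"
    using content_ball_pos[of 1 "0::'a"] by (auto simp: measure_def)
  moreover have "?c \<noteq> top"
    using emeasure_lborel_ball_finite[of "0::'a" 1] by auto
  ultimately show "emeasure (distr lborel borel T) A = emeasure lborel A"
    by (simp add: ennreal_mult_cancel_left)
qed

section \<open>Rotations by unimodular scalars, and integrals over balls and circles\<close>

lemma norm_cscale [simp]: "norm (c *s (z :: complex ^ 'n)) = cmod c * norm z"
  by (simp add: norm_vec_def L2_set_def norm_mult power_mult_distrib sum_distrib_left[symmetric] real_sqrt_mult)

lemma linear_cscale: "linear (\<lambda>z :: complex ^ 'n. c *s z)"
  by (rule linearI) (auto simp: vec_eq_iff algebra_simps)

lemma lborel_distr_cscale:
  assumes "cmod c = 1"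
  shows "distr lborel borel (\<lambda>z :: complex ^ 'n::finite. c *s z) = lborel"
proof -
  have "c \<noteq> 0" using assms by auto
  then show ?thesis
    by (intro lborel_distr_isometry[where T' = "\<lambda>z. inverse c *s z"])
      (use assms in \<open>auto simp: linear_cscale\<close>)
qed

lemma continuous_on_cscale [continuous_intros]:
  fixes g :: "'a::topological_space \<Rightarrow> complex ^ 'n::finite"
  assumes "continuous_on S f" "continuous_on S g"
  shows "continuous_on S (\<lambda>x. f x *s g x)"
proof -
  have "(\<lambda>x. f x *s g x) = (\<lambda>x. \<chi> i. f x * g x $ i)" by (auto simp: vec_eq_iff)
  then show ?thesis
    using assms by (simp only:) (intro continuous_on_vec_lambda continuous_intros)
qed

text \<open>A radius below 1 keeps the weight continuous on the closed ball, so that signed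
  continuous \<open>u\<close> are integrable and differences can be formed. For nonnegative
  \<open>u\<close>, \<open>weighted_integral\<close> is recovered as the radius tends to 1.\<close>

definition ball_integral :: "real \<Rightarrow> real \<Rightarrow> (complex ^ 'n::finite \<Rightarrow> real) \<Rightarrow> real" where
  "ball_integral \<alpha> r u =
     (\<integral>z. indicator (cball 0 r) z *\<^sub>R (u z * (1 - (norm z)\<^sup>2) powr \<alpha>) \<partial>lborel)"

definition circle_integral :: "(complex ^ 'n::finite \<Rightarrow> real) \<Rightarrow> complex ^ 'n \<Rightarrow> real" where
  "circle_integral u z = integral {0..2*pi} (\<lambda>t. u (cis t *s z))"

lemma one_minus_norm_sq_pos: "norm z < 1 \<Longrightarrow> 0 < 1 - (norm z)\<^sup>2"
  by (simp add: power_less_one_iff abs_square_less_1)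

lemma continuous_on_weight:
  assumes "S \<subseteq> ball 0 1" "continuous_on S u"
  shows "continuous_on S (\<lambda>z :: complex ^ 'n::finite. u z * (1 - (norm z)\<^sup>2) powr \<alpha> :: real)"
  using assms(1)
  by (intro continuous_intros assms) (auto dest!: subsetD one_minus_norm_sq_pos)

lemma ball_integrable:
  assumes "continuous_on (ball 0 1) u" "r < 1"
  shows "integrable lborel (\<lambda>z :: complex ^ 'n::finite. indicator (cball 0 r) z *\<^sub>R (u z * (1 - (norm z)\<^sup>2) powr \<alpha> :: real))"
  using assms
  by (intro borel_integrable_compact continuous_on_weight)
    (auto intro: continuous_on_subset)

lemma continuous_on_circle_integral:
  assumes "continuous_on (ball 0 1) u"
  shows "continuous_on (ball 0 1) (circle_integral u)"
proof -
  have "continuous_on (ball 0 1 \<times> cbox 0 (2*pi)) (\<lambda>(z, t). u (cis t *s z))"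
    unfolding split_beta
    by (rule continuous_on_compose2[OF assms]) (auto intro!: continuous_intros)
  from integral_continuous_on_param[OF this] show ?thesis
    by (simp add: circle_integral_def[abs_def])
qed

text \<open>Fubini on \<open>{0..2*pi} \<times> cball 0 r\<close>: each rotation preserves Lebesgue
  measure, the ball and the weight, so every angle contributes the same amount. Comparisons of
  integrals over balls thereby reduce to single circles.\<close>

lemma ball_integral_circle_integral:
  fixes u :: "complex ^ 'n::finite \<Rightarrow> real"
  assumes u: "continuous_on (ball 0 1) u" and r: "r < 1"
  shows "ball_integral \<alpha> r (circle_integral u) = 2 * pi * ball_integral \<alpha> r u"
proof -
  let ?g = "\<lambda>t z. indicator ({0..2*pi} \<times> cball 0 r) (t, z) *\<^sub>R
    (u (cis t *s z) * (1 - (norm z)\<^sup>2) powr \<alpha>) :: real"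
  have cont: "continuous_on ({0..2*pi} \<times> cball 0 r)
     (\<lambda>p. u (cis (fst p) *s snd p) * (1 - (norm (snd p))\<^sup>2) powr \<alpha>)"
    using r
    by (intro continuous_intros continuous_on_compose2[OF u])
      (auto dest!: order_le_less_trans one_minus_norm_sq_pos)
  have int: "integrable (lborel \<Otimes>\<^sub>M lborel) (\<lambda>(t, z). ?g t z)"
    using borel_integrable_compact[OF compact_Times[OF compact_Icc compact_cball] cont]
    by (simp add: lborel_prod case_prod_unfold)
  have "(\<integral>z. (\<integral>t. ?g t z \<partial>lborel) \<partial>lborel) = (\<integral>t. (\<integral>z. ?g t z \<partial>lborel) \<partial>lborel)"
    by (rule lborel_pair.Fubini_integral[OF int])
  moreover have "(\<integral>t. ?g t z \<partial>lborel) =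
      indicator (cball 0 r) z *\<^sub>R (circle_integral u z * (1 - (norm z)\<^sup>2) powr \<alpha>)" for z
  proof (cases "z \<in> cball 0 r")
    case True
    then have "continuous_on {0..2*pi} (\<lambda>t. u (cis t *s z))"
      using r by (intro continuous_on_compose2[OF u]) (auto intro!: continuous_intros)
    then have "(LINT t:{0..2*pi}|lborel. u (cis t *s z)) = circle_integral u z"
      unfolding circle_integral_def set_integrable_def
      by (intro set_borel_integral_eq_integral(2) borel_integrable_compact[folded set_integrable_def]) auto
    with True show ?thesis
      by (simp add: indicator_times mult.assoc[symmetric] set_lebesgue_integral_def)
  qed (simp add: indicator_times)
  moreover have "(\<integral>z. ?g t z \<partial>lborel) = indicator {0..2*pi} t *\<^sub>R ball_integral \<alpha> r u" for t
  proof -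
    have [measurable]: "(\<lambda>z :: complex ^ 'n. cis t *s z) \<in> borel_measurable borel"
      by (intro borel_measurable_continuous_onI continuous_intros)
    have "ball_integral \<alpha> r u = (\<integral>z. indicator (cball 0 r) z *\<^sub>R (u z * (1 - (norm z)\<^sup>2) powr \<alpha>)
      \<partial>distr lborel borel (\<lambda>z :: complex ^ 'n. cis t *s z))"
      by (simp add: ball_integral_def lborel_distr_cscale)
    also have "\<dots> = (\<integral>z. indicator (cball 0 r) (cis t *s z) *\<^sub>R
        (u (cis t *s z) * (1 - (norm (cis t *s z))\<^sup>2) powr \<alpha>) \<partial>lborel)"
      using borel_measurable_integrable[OF ball_integrable[OF u r, of \<alpha>]]
      by (intro integral_distr) auto
    finally show ?thesis
      by (auto simp: indicator_def)
  qed
  ultimately show ?thesis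
    by (simp add: ball_integral_def)
qed

section \<open>Parseval on the unit circle\<close>

text \<open>Cauchy's formula for the \<open>m\<close>-th derivative on the unit circle, conjugated,
  where \<open>cnj (cis t)\<close> is the inverse of \<open>cis t\<close>. For \<open>m = 0\<close>
  it is the mean value property.\<close>

lemma fourier_coefficient_holomorphic:
  assumes "f holomorphic_on ball 0 R" "1 < R"
  shows "((\<lambda>t. cnj (f (cis t)) * cis t ^ m) has_integral 2 * pi * cnj ((deriv ^^ m) f 0 / fact m)) {0..2*pi}"
proof -
  have sub: "cball 0 1 \<subseteq> ball (0::complex) R" using assms(2) by auto
  have "((\<lambda>u. f u / (u - 0) ^ Suc m) has_contour_integral (2 * pi * \<i>) / fact m * (deriv ^^ m) f 0)
          (circlepath 0 1)"
    using sub by (intro Cauchy_has_contour_integral_higher_derivative_circlepath)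
      (auto intro!: holomorphic_on_imp_continuous_on holomorphic_on_subset[OF assms(1)])
  then have "((\<lambda>t. f (cis t) / cis t ^ Suc m * \<i> * cis t) has_integral
      (2 * pi * \<i>) / fact m * (deriv ^^ m) f 0) {0..2*pi}"
    by (simp add: circlepath_def has_contour_integral_part_circlepath_iff)
  from has_integral_mult_right[OF this, of "- \<i>"]
  have "((\<lambda>t. f (cis t) / cis t ^ m) has_integral 2 * pi * (deriv ^^ m) f 0 / fact m) {0..2*pi}"
    by (simp add: field_simps)
  from has_integral_linear[OF this bounded_linear_cnj]
  have "((\<lambda>t. cnj (f (cis t)) / cnj (cis t) ^ m) has_integral cnj (2 * pi * (deriv ^^ m) f 0 / fact m)) {0..2*pi}"
    by (simp add: o_def)
  moreover have "cnj (f (cis t)) / cnj (cis t) ^ m = cnj (f (cis t)) * cis t ^ m" for t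
    by (simp add: cis_cnj field_simps cis_mult flip: power_mult_distrib)
  ultimately show ?thesis
    by simp
qed

text \<open>Only \<open>g\<close> is expanded: as \<open>R > 1\<close>, its Taylor series converges
  uniformly on the unit circle and may be integrated term by term against \<open>cnj f\<close>,
  where \<open>fourier_coefficient_holomorphic\<close> evaluates each term.\<close>

lemma parseval_holomorphic:
  assumes f: "f holomorphic_on ball 0 R" and g: "g holomorphic_on ball 0 R" and R: "1 < R"
  shows "(\<lambda>m. 2 * pi * (cnj ((deriv ^^ m) f 0 / fact m) * ((deriv ^^ m) g 0 / fact m))) sums
           integral {0..2*pi} (\<lambda>t. cnj (f (cis t)) * g (cis t))"
proof -
  define b where "b m = (deriv ^^ m) g 0 / fact m" for m
  have g_sums: "(\<lambda>m. b m * w ^ m) sums g w" if "w \<in> ball 0 R" for w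
    using holomorphic_power_series[OF g that] by (simp add: b_def)
  have cf: "continuous_on {0..2*pi} (\<lambda>t. cnj (f (cis t)))"
    using R by (intro continuous_intros continuous_on_compose2[OF holomorphic_on_imp_continuous_on[OF f]]) auto
  have "compact ((\<lambda>t. cnj (f (cis t))) ` {0..2*pi})"
    by (intro compact_continuous_image cf) auto
  then have "bounded ((\<lambda>t. cnj (f (cis t))) ` {0..2*pi})" by (rule compact_imp_bounded)
  then obtain B where B: "\<And>t. t \<in> {0..2*pi} \<Longrightarrow> norm (cnj (f (cis t))) \<le> B"
    unfolding bounded_iff by blast
  \<comment> \<open>The point \<open>(1 + R) / 2\<close> lies strictly between 1 and
    \<open>R\<close>; convergence there forces absolute convergence at 1, which supplies the
    majorant for the M-test.\<close>
  have "summable (\<lambda>m. norm (b m * 1 ^ m))"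
    using R by (intro powser_insidea[OF sums_summable[OF g_sums[of "of_real ((1 + R) / 2)"]]])
      (auto simp flip: of_real_add)
  then have sb: "summable (\<lambda>m. B * norm (b m))" by (simp add: summable_mult)
  have "uniform_limit {0..2*pi} (\<lambda>n t. \<Sum>m<n. cnj (f (cis t)) * (b m * cis t ^ m))
          (\<lambda>t. \<Sum>m. cnj (f (cis t)) * (b m * cis t ^ m)) sequentially"
    using B by (intro Weierstrass_m_test[OF _ sb]) (auto simp: norm_mult norm_power intro!: mult_right_mono)
  also have "?this \<longleftrightarrow> uniform_limit {0..2*pi} (\<lambda>n t. \<Sum>m<n. cnj (f (cis t)) * (b m * cis t ^ m))
          (\<lambda>t. cnj (f (cis t)) * g (cis t)) sequentially"
    using R by (intro uniform_limit_cong') (auto intro!: sums_unique[symmetric] sums_mult g_sums)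
  finally obtain I J where I: "\<And>n. ((\<lambda>t. \<Sum>m<n. cnj (f (cis t)) * (b m * cis t ^ m)) has_integral I n) {0..2*pi}"
    and J: "((\<lambda>t. cnj (f (cis t)) * g (cis t)) has_integral J) {0..2*pi}" and IJ: "I \<longlonglongrightarrow> J"
    by (rule uniform_limit_integral) (auto intro!: continuous_intros cf)
  have "((\<lambda>t. \<Sum>m<n. cnj (f (cis t)) * (b m * cis t ^ m)) has_integral
      (\<Sum>m<n. 2 * pi * (cnj ((deriv ^^ m) f 0 / fact m) * b m))) {0..2*pi}" for n
  proof (intro has_integral_sum)
    show "((\<lambda>t. cnj (f (cis t)) * (b m * cis t ^ m)) has_integral
      2 * pi * (cnj ((deriv ^^ m) f 0 / fact m) * b m)) {0..2*pi}" for m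
      using has_integral_mult_right[OF fourier_coefficient_holomorphic[OF f R, of m], of "b m"]
      by (simp add: mult_ac)
  qed auto
  then have "I = (\<lambda>n. \<Sum>m<n. 2 * pi * (cnj ((deriv ^^ m) f 0 / fact m) * b m))"
    using I by (auto intro: has_integral_unique)
  with IJ integral_unique[OF J] show ?thesis
    by (simp add: sums_def b_def)
qed

text \<open>The operator \<open>w * deriv f w\<close> multiplies the \<open>m\<close>-th Taylor
  coefficient by \<open>m\<close>, so Parseval gives \<open>I\<close> as the sum of
  \<open>2 * pi * (m - 1) * (cmod (a m))^2\<close>. The only negative factor, at
  \<open>m = 0\<close>, meets \<open>a 0 = 0\<close>; if the sum vanishes, only \<open>a 1\<close>
  can survive.\<close>

lemma circle_integral_rotation_minus_id:
  assumes f: "f holomorphic_on ball 0 R" and R: "1 < R" and f0: "f 0 = 0"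
  defines "I \<equiv> integral {0..2*pi} (\<lambda>t. Re (cnj (f (cis t)) * (cis t * deriv f (cis t) - f (cis t))))"
  shows "0 \<le> I" and "I = 0 \<Longrightarrow> w \<in> ball 0 R \<Longrightarrow> f w = w * deriv f 0"
proof -
  define a where "a m = (deriv ^^ m) f 0 / fact m" for m
  define g where "g w = w * deriv f w - f w" for w
  have g: "g holomorphic_on ball 0 R"
    unfolding g_def by (intro holomorphic_intros f) auto
  have g_coeff: "(deriv ^^ m) g 0 / fact m = (of_nat m - 1) * a m" for m
  proof -
    have *: "deriv f holomorphic_on ball 0 R" by (intro holomorphic_intros f) auto
    have "(deriv ^^ m) g 0 = (deriv ^^ m) (\<lambda>w. w * deriv f w) 0 - (deriv ^^ m) f 0"
      unfolding g_def using R
      by (intro higher_deriv_diff[where S = "ball 0 R"] holomorphic_intros f) auto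
    also have "(deriv ^^ m) (\<lambda>w. w * deriv f w) 0 = of_nat m * (deriv ^^ m) f 0"
    proof (cases m)
      case (Suc k)
      have "(deriv ^^ m) (\<lambda>w. w * deriv f w) 0 =
          (\<Sum>j = 0..m. of_nat (m choose j) * (deriv ^^ j) (\<lambda>w. w) 0 * (deriv ^^ (m - j)) (deriv f) 0)"
        using R by (intro higher_deriv_mult[where S = "ball 0 R"] holomorphic_intros *) auto
      \<comment> \<open>At 0 every derivative of the identity vanishes except the first, which
        leaves one term of the Leibniz sum.\<close>
      also have "\<dots> = (\<Sum>j \<in> {1}. of_nat (m choose j) * (deriv ^^ j) (\<lambda>w. w) 0 * (deriv ^^ (m - j)) (deriv f) 0)"
        using Suc by (intro sum.mono_neutral_right) (auto simp: higher_deriv_ident)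
      finally show ?thesis
        using Suc by (simp add: funpow_Suc_right del: funpow.simps)
    qed auto
    finally show ?thesis by (simp add: a_def field_simps)
  qed
  have ga: "cnj (a m) * ((of_nat m - 1) * a m) = of_real ((real m - 1) * (cmod (a m))\<^sup>2)" for m
    by (simp only: of_real_mult complex_norm_square) simp
  have "(\<lambda>m. Re (2 * pi * (cnj (a m) * ((of_nat m - 1) * a m)))) sums
      Re (integral {0..2*pi} (\<lambda>t. cnj (f (cis t)) * g (cis t)))"
    using parseval_holomorphic[OF f g R] unfolding g_coeff a_def[symmetric]
    by (rule sums_Re)
  also have "Re (integral {0..2*pi} (\<lambda>t. cnj (f (cis t)) * g (cis t))) = I"
    unfolding I_def g_def[symmetric]
    by (subst integral_linear[OF _ bounded_linear_Re, unfolded o_def])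
      (use R in \<open>auto intro!: integrable_continuous_real continuous_intros
        continuous_on_compose2[OF holomorphic_on_imp_continuous_on[OF f]]
        continuous_on_compose2[OF holomorphic_on_imp_continuous_on[OF g]]\<close>)
  finally have S: "(\<lambda>m. 2 * pi * ((real m - 1) * (cmod (a m))\<^sup>2)) sums I"
    unfolding ga by simp
  have a0: "a 0 = 0" using f0 by (simp add: a_def)
  have nonneg: "0 \<le> 2 * pi * ((real m - 1) * (cmod (a m))\<^sup>2)" for m
    by (cases m) (auto simp: a0)
  show "0 \<le> I" by (rule sums_le[OF nonneg sums_zero S])
  assume "I = 0" and w: "w \<in> ball 0 R"
  then have "2 * pi * ((real m - 1) * (cmod (a m))\<^sup>2) = 0" for m
    using S nonneg suminf_eq_zero_iff[of "\<lambda>m. 2 * pi * ((real m - 1) * (cmod (a m))\<^sup>2)"]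
    by (auto simp: sums_iff)
  then have am: "a m = 0" if "m \<noteq> 1" for m
    using that by (auto simp: a0)
  have "(\<lambda>m. a m * w ^ m) sums f w"
    using holomorphic_power_series[OF f w] by (simp add: a_def)
  moreover have "(\<lambda>m. a m * w ^ m) sums (\<Sum>m\<in>{1}. a m * w ^ m)"
    by (rule sums_finite) (auto simp: am)
  ultimately show "f w = w * deriv f 0"
    using sums_unique2 by (force simp: a_def)
qed

section \<open>Holomorphic functions and closed forms in several variables\<close>

lemma axis_eq_cscale: "axis k w = w *s axis k (1::complex)"
  by (simp add: vec_eq_iff axis_def)

lemma bounded_linear_axis: "bounded_linear (axis k :: complex \<Rightarrow> complex ^ 'n::finite)"
  by (rule linear_conv_bounded_linear[THEN iffD1], rule linearI) (auto simp: vec_eq_iff axis_def)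

lemma norm_axis_complex [simp]: "norm (axis k w :: complex ^ 'n::finite) = cmod w"
  by (simp add: norm_vec_def L2_set_def axis_def if_distrib[of norm] if_distrib[of "\<lambda>x. x\<^sup>2"] cong: if_cong)

lemma has_derivative_add_axis:
  "((\<lambda>w. z + axis k w) has_derivative (axis k :: complex \<Rightarrow> complex ^ 'n::finite)) (at x)"
  using bounded_linear_imp_has_derivative[OF bounded_linear_axis]
  by (auto intro!: derivative_eq_intros)

lemma axis_zero [simp]: "axis k 0 = (0 :: complex ^ 'n)"
  by (simp add: vec_eq_iff axis_def)

text \<open>A complex linear derivative is determined by its values on the vectors
  \<open>axis k 1\<close>; restricting \<open>g\<close> to the coordinate lines through
  \<open>z\<close> identifies these values with the partial derivatives.\<close>

lemma holomorphic_Cn_has_derivative: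
  fixes g :: "complex ^ 'n::finite \<Rightarrow> complex"
  assumes "holomorphic_Cn g S" "z \<in> S"
  shows "(g has_derivative (\<lambda>h. \<Sum>k\<in>UNIV. h $ k * partial_deriv k g z)) (at z)"
proof -
  obtain D where D: "(g has_derivative D) (at z)" and Dc: "\<And>c h. D (c *s h) = c * D h"
    using assms by (auto simp: holomorphic_Cn_def)
  have partial: "partial_deriv k g z = D (axis k 1)" for k
  proof -
    have "((\<lambda>w. g (z + axis k w)) has_derivative (\<lambda>w. D (axis k w))) (at 0)"
      using D by (intro has_derivative_compose[OF has_derivative_add_axis, of g]) simp
    then have "((\<lambda>w. g (z + axis k w)) has_field_derivative D (axis k 1)) (at 0)"
      by (rule has_derivative_imp_has_field_derivative) (subst axis_eq_cscale, simp add: Dc)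
    then show ?thesis unfolding partial_deriv_def by (rule DERIV_imp_deriv)
  qed
  have "D = (\<lambda>h. \<Sum>k\<in>UNIV. h $ k * partial_deriv k g z)"
  proof
    fix h
    have "D h = D (\<Sum>k\<in>UNIV. h $ k *s axis k 1)"
      by (simp add: basis_expansion)
    also have "\<dots> = (\<Sum>k\<in>UNIV. h $ k * D (axis k 1))"
      by (simp add: linear_sum[OF has_derivative_linear[OF D]] Dc)
    finally show "D h = (\<Sum>k\<in>UNIV. h $ k * partial_deriv k g z)"
      by (simp add: partial)
  qed
  with D show ?thesis by simp
qed

lemma holomorphic_Cn_slice_derivative:
  fixes g :: "complex ^ 'n::finite \<Rightarrow> complex"
  assumes "holomorphic_Cn g S" "a + w *s b \<in> S"
  shows "((\<lambda>w. g (a + w *s b)) has_field_derivative (\<Sum>k\<in>UNIV. b $ k * partial_deriv k g (a + w *s b))) (at w)"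
proof -
  have "bounded_linear (\<lambda>w. w *s b)"
    by (rule linear_conv_bounded_linear[THEN iffD1], rule linearI) (auto simp: vec_eq_iff algebra_simps)
  then have "((\<lambda>w. a + w *s b) has_derivative (\<lambda>w. w *s b)) (at w)"
    by (auto intro!: derivative_eq_intros bounded_linear_imp_has_derivative)
  from has_derivative_compose[OF this holomorphic_Cn_has_derivative[OF assms]]
  show ?thesis
    by (rule has_derivative_imp_has_field_derivative) (simp add: sum_distrib_left sum_distrib_right mult_ac)
qed

lemma holomorphic_Cn_imp_continuous_on:
  "holomorphic_Cn g S \<Longrightarrow> continuous_on S g"
  unfolding holomorphic_Cn_def
  by (meson continuous_at_imp_continuous_on has_derivative_continuous)

text \<open>As \<open>x\<close> tends to \<open>z\<close>, the one-variable restrictions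
  \<open>w \<mapsto> g (x + axis k w)\<close> converge uniformly on a disc, by continuity of
  \<open>g\<close> and compactness. Derivatives of holomorphic functions converge along uniform
  limits (Weierstrass).\<close>

lemma continuous_on_partial_deriv:
  fixes g :: "complex ^ 'n::finite \<Rightarrow> complex"
  assumes g: "holomorphic_Cn g S" and S: "open S"
  shows "continuous_on S (partial_deriv k g)"
proof (rule continuous_at_imp_continuous_on, rule ballI)
  fix z assume "z \<in> S"
  then obtain e where "0 < e" and e: "ball z e \<subseteq> S"
    using S by (meson open_contains_ball)
  \<comment> \<open>Half the radius, because \<open>x\<close> may move by \<open>d\<close> and the
    coordinate \<open>w\<close> by another \<open>d\<close>.\<close>
  define d where "d = e / 2"
  have d: "0 < d" using \<open>0 < e\<close> by (simp add: d_def)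
  have in_S: "x + axis k w \<in> S" if "x \<in> ball z d" "w \<in> cball 0 d" for x w
  proof -
    have "dist z (x + axis k w) \<le> dist z x + norm (axis k w :: complex ^ 'n)"
      using norm_triangle_ineq4[of "z - x" "axis k w"] by (simp add: dist_norm algebra_simps)
    also have "\<dots> < d + d" using that by (intro add_less_le_mono) (auto simp: dist_norm)
    finally show ?thesis using e by (auto simp: d_def)
  qed
  let ?f = "\<lambda>x w. g (x + axis k w)"
  have cont: "continuous_on (ball z d \<times> cball 0 d) (\<lambda>(x, w). ?f x w)"
    unfolding split_beta using in_S
    by (intro continuous_on_compose2[OF holomorphic_Cn_imp_continuous_on[OF g]] continuous_intros
        bounded_linear.continuous_on[OF bounded_linear_axis]) auto
  have "uniform_limit (ball 0 d) ?f (?f z) (at z)"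
  proof (rule uniform_limitI)
    fix \<epsilon> :: real assume "0 < \<epsilon>"
    then obtain X where "z \<in> X" "open X"
      and X: "\<forall>x\<in>X \<inter> ball z d. \<forall>w\<in>cball 0 d. dist (?f x w) (?f z w) \<le> \<epsilon> / 2"
      using continuous_on_prod_compactE[OF cont compact_cball, of z "\<epsilon> / 2"] d by auto
    then have "\<forall>\<^sub>F x in at z. x \<in> X \<inter> ball z d"
      using d by (intro eventually_at_in_open') auto
    then show "\<forall>\<^sub>F x in at z. \<forall>w\<in>ball 0 d. dist (?f x w) (?f z w) < \<epsilon>"
    proof eventually_elim
      case (elim x)
      show ?case
      proof
        fix w :: complex assume "w \<in> ball 0 d"
        then have "dist (?f x w) (?f z w) \<le> \<epsilon> / 2" using X elim by auto
        with \<open>0 < \<epsilon>\<close> show "dist (?f x w) (?f z w) < \<epsilon>" by simp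
      qed
    qed
  qed
  moreover have "\<forall>\<^sub>F x in at z. ?f x holomorphic_on ball 0 d"
  proof (rule eventually_mono)
    show "\<forall>\<^sub>F x in at z. x \<in> ball z d" using d by (intro eventually_at_in_open') auto
    fix x assume x: "x \<in> ball z d"
    have "(\<lambda>w. g (x + w *s axis k 1)) holomorphic_on ball 0 d"
      using x in_S[of x]
      by (subst holomorphic_on_open)
        (force simp flip: axis_eq_cscale intro: holomorphic_Cn_slice_derivative[OF g, of x _ "axis k 1", folded axis_eq_cscale])+
    then show "?f x holomorphic_on ball 0 d" by (subst axis_eq_cscale)
  qed
  ultimately have "((\<lambda>x. (deriv ^^ 1) (?f x) 0) \<longlongrightarrow> (deriv ^^ 1) (?f z) 0) (at z)"
    using d by (intro higher_deriv_complex_uniform_limit) auto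
  then show "isCont (partial_deriv k g) z"
    by (simp add: isCont_def partial_deriv_def[abs_def])
qed

section \<open>The Poincare lemma for closed holomorphic 1-forms\<close>

lemma holomorphic_Cn_partial_deriv_eqI:
  fixes f :: "complex ^ 'n::finite \<Rightarrow> complex"
  assumes "(f has_derivative (\<lambda>h. \<Sum>k\<in>UNIV. h $ k * c k)) (at z)"
  shows "partial_deriv k f z = c k"
proof -
  have "((\<lambda>w. f (z + axis k w)) has_derivative (\<lambda>w. \<Sum>j\<in>UNIV. axis k w $ j * c j)) (at 0)"
    using assms by (intro has_derivative_compose[OF has_derivative_add_axis, of f]) simp
  also have "(\<lambda>w. \<Sum>j\<in>UNIV. axis k w $ j * c j) = (*) (c k)"
    by (auto simp: axis_def if_distribR if_distrib[of "\<lambda>x. x * _"] sum.delta' cong: if_cong)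
  finally show ?thesis
    unfolding partial_deriv_def by (intro DERIV_imp_deriv) (simp add: has_field_derivative_def)
qed

text \<open>Differentiation under the integral sign, combined with closedness, turns the integrand
  into a total \<open>t\<close>-derivative, so that the fundamental theorem of calculus evaluates
  the integral.\<close>

lemma closed_form_primitive:
  fixes \<eta> :: "'n::finite \<Rightarrow> complex ^ 'n \<Rightarrow> complex"
  assumes hol: "\<And>k. holomorphic_Cn (\<eta> k) (ball 0 1)"
    and closed: "\<And>j k z. z \<in> ball 0 1 \<Longrightarrow> partial_deriv k (\<eta> j) z = partial_deriv j (\<eta> k) z"
  defines "f \<equiv> \<lambda>z. integral {0..1} (\<lambda>t::real. \<Sum>k\<in>UNIV. z $ k * \<eta> k (t *\<^sub>R z))"
  shows "z \<in> ball 0 1 \<Longrightarrow> (f has_derivative (\<lambda>h. \<Sum>k\<in>UNIV. h $ k * \<eta> k z)) (at z)"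
proof -
  assume z: "z \<in> ball 0 1"
  \<comment> \<open>The derivative of the integrand in \<open>z\<close>, with closedness already
    used to exchange the indices of the partials. The factor of \<open>h $ j\<close> is the
    \<open>t\<close>-derivative of \<open>t * \<eta> j (t *\<^sub>R z)\<close>.\<close>
  define D where "D z t = (\<lambda>h. \<Sum>j\<in>UNIV. h $ j *
    (\<eta> j (t *\<^sub>R z) + of_real t * (\<Sum>k\<in>UNIV. z $ k * partial_deriv k (\<eta> j) (t *\<^sub>R z))))" for z and t :: real
  have in_ball: "t *\<^sub>R x \<in> ball 0 1" if "x \<in> ball 0 1" "t \<in> {0..1}" for t :: real and x :: "complex ^ 'n"
  proof -
    have "\<bar>t\<bar> * norm x \<le> 1 * norm x" using that by (intro mult_right_mono) auto
    also have "\<dots> < 1" using that by simp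
    finally show ?thesis by simp
  qed
  have hd: "((\<lambda>y. \<eta> k (u y)) has_derivative
      (\<lambda>h. \<Sum>j\<in>UNIV. u' h $ j * partial_deriv j (\<eta> k) (u y))) (at y within X)"
    if "(u has_derivative u') (at y within X)" "u y \<in> ball 0 1"
    for k u u' X and y :: "'b::real_normed_vector"
    using has_derivative_compose[OF that(1) holomorphic_Cn_has_derivative[OF hol that(2)]] .
  have bl: "bounded_linear (D z t)" for z t
    unfolding D_def
    by (rule linear_conv_bounded_linear[THEN iffD1], rule linearI)
      (simp_all add: sum.distrib distrib_right scaleR_right.sum)
  have cont_\<eta>: "continuous_on (ball 0 1 \<times> {0..1}) (\<lambda>p. \<eta> k (snd p *\<^sub>R fst p))" for k
    using in_ball by (intro continuous_on_compose2[OF holomorphic_Cn_imp_continuous_on[OF hol]]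
        continuous_intros) auto
  have cont_p: "continuous_on (ball 0 1 \<times> {0..1}) (\<lambda>p. partial_deriv j (\<eta> k) (snd p *\<^sub>R fst p))" for j k
    using in_ball by (intro continuous_on_compose2[OF continuous_on_partial_deriv[OF hol]]
        continuous_intros) auto
  have contD: "continuous_on (ball 0 1 \<times> cbox 0 1) (\<lambda>(z, t). Blinfun (D z t))"
    by (rule continuous_on_blinfun_componentwise)
      (simp add: split_beta bounded_linear_Blinfun_apply bl, simp add: D_def,
        intro continuous_intros cont_\<eta> cont_p)
  have "((\<lambda>z. integral (cbox 0 1) (\<lambda>t. \<Sum>k\<in>UNIV. z $ k * \<eta> k (t *\<^sub>R z))) has_derivative
      blinfun_apply (integral (cbox 0 1) (\<lambda>t. Blinfun (D z t)))) (at z within ball 0 1)"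
  proof (rule leibniz_rule[where U = "ball 0 1"])
    fix x t assume x: "x \<in> ball (0 :: complex ^ 'n) 1" and t: "t \<in> cbox 0 (1::real)"
    have "((\<lambda>x. t *\<^sub>R x) has_derivative (\<lambda>h. t *\<^sub>R h)) (at x within ball 0 1)"
      by (auto intro!: derivative_eq_intros)
    then have d1: "((\<lambda>x. \<eta> k (t *\<^sub>R x)) has_derivative
        (\<lambda>h. \<Sum>j\<in>UNIV. (t *\<^sub>R h) $ j * partial_deriv j (\<eta> k) (t *\<^sub>R x))) (at x within ball 0 1)" for k
      using x t in_ball by (intro hd) auto
    have d2: "((\<lambda>x. x $ k) has_derivative (\<lambda>h. h $ k)) (at x within ball 0 1)" for k
      by (rule bounded_linear_imp_has_derivative) (rule bounded_linear_vec_nth)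
    have "((\<lambda>x. \<Sum>k\<in>UNIV. x $ k * \<eta> k (t *\<^sub>R x)) has_derivative
        (\<lambda>h. \<Sum>k\<in>UNIV. x $ k * (\<Sum>j\<in>UNIV. (t *\<^sub>R h) $ j * partial_deriv j (\<eta> k) (t *\<^sub>R x))
           + h $ k * \<eta> k (t *\<^sub>R x))) (at x within ball 0 1)"
      by (intro has_derivative_sum has_derivative_mult d1 d2)
    also have "(\<lambda>h. \<Sum>k\<in>UNIV. x $ k * (\<Sum>j\<in>UNIV. (t *\<^sub>R h) $ j * partial_deriv j (\<eta> k) (t *\<^sub>R x))
           + h $ k * \<eta> k (t *\<^sub>R x)) = D x t"
    proof
      fix h
      have "(\<Sum>k\<in>UNIV. x $ k * (\<Sum>j\<in>UNIV. (t *\<^sub>R h) $ j * partial_deriv j (\<eta> k) (t *\<^sub>R x))) =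
          (\<Sum>k\<in>UNIV. \<Sum>j\<in>UNIV. h $ j * (of_real t * (x $ k * partial_deriv k (\<eta> j) (t *\<^sub>R x))))"
        using closed[OF in_ball[OF x]] t
        by (simp add: sum_distrib_left mult_ac scaleR_conv_of_real[where 'a = complex])
      also have "\<dots> = (\<Sum>j\<in>UNIV. h $ j * (of_real t * (\<Sum>k\<in>UNIV. x $ k * partial_deriv k (\<eta> j) (t *\<^sub>R x))))"
        by (subst sum.swap) (simp add: sum_distrib_left)
      finally show "(\<Sum>k\<in>UNIV. x $ k * (\<Sum>j\<in>UNIV. (t *\<^sub>R h) $ j * partial_deriv j (\<eta> k) (t *\<^sub>R x))
           + h $ k * \<eta> k (t *\<^sub>R x)) = D x t h"
        by (simp add: D_def sum.distrib distrib_left)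
    qed
    finally show "((\<lambda>x. \<Sum>k\<in>UNIV. x $ k * \<eta> k (t *\<^sub>R x)) has_derivative blinfun_apply (Blinfun (D x t)))
        (at x within ball 0 1)"
      by (simp add: bounded_linear_Blinfun_apply bl)
  next
    fix x assume x: "x \<in> ball (0 :: complex ^ 'n) 1"
    show "(\<lambda>t::real. \<Sum>k\<in>UNIV. x $ k * \<eta> k (t *\<^sub>R x)) integrable_on cbox 0 1"
      by (rule integrable_continuous)
        (use in_ball[OF x] in \<open>auto intro!: continuous_intros
          continuous_on_compose2[OF holomorphic_Cn_imp_continuous_on[OF hol]]\<close>)
  qed (use contD z in auto)
  then have "(f has_derivative blinfun_apply (integral (cbox 0 1) (\<lambda>t. Blinfun (D z t)))) (at z)"
    using z by (simp add: f_def at_within_open[OF z])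
  moreover have "blinfun_apply (integral (cbox 0 1) (\<lambda>t. Blinfun (D z t))) h = (\<Sum>k\<in>UNIV. h $ k * \<eta> k z)" for h
  proof -
    have "continuous_on (cbox 0 1) (\<lambda>t. Blinfun (D z t))"
      using z by (intro continuous_on_compose2[OF contD, where f = "\<lambda>t. (z, t)", simplified]) (auto intro!: continuous_intros)
    then have "blinfun_apply (integral (cbox 0 1) (\<lambda>t. Blinfun (D z t))) h =
        integral (cbox 0 1) (\<lambda>t. D z t h)"
      by (subst integral_linear[OF integrable_continuous blinfun.bounded_linear_left, unfolded o_def, symmetric])
        (auto simp: bounded_linear_Blinfun_apply bl)
    \<comment> \<open>The factor \<open>of_real t\<close> in the antiderivative makes the lower
      endpoint contribute nothing.\<close>
    also have "\<dots> = (\<Sum>k\<in>UNIV. h $ k * (of_real 1 * \<eta> k (1 *\<^sub>R z))) - (\<Sum>k\<in>UNIV. h $ k * (of_real 0 * \<eta> k (0 *\<^sub>R z)))"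
    proof (rule integral_unique, unfold cbox_interval, rule fundamental_theorem_of_calculus)
      fix t :: real assume t: "t \<in> {0..1}"
      have "((\<lambda>t. t *\<^sub>R z) has_derivative (\<lambda>s. s *\<^sub>R z)) (at t within {0..1})"
        by (auto intro!: derivative_eq_intros)
      then have "((\<lambda>t. \<eta> k (t *\<^sub>R z)) has_derivative
          (\<lambda>s. \<Sum>j\<in>UNIV. (s *\<^sub>R z) $ j * partial_deriv j (\<eta> k) (t *\<^sub>R z))) (at t within {0..1})" for k
        using z t in_ball by (intro hd) auto
      then have "((\<lambda>t. \<eta> k (t *\<^sub>R z)) has_vector_derivative
          (\<Sum>j\<in>UNIV. z $ j * partial_deriv j (\<eta> k) (t *\<^sub>R z))) (at t within {0..1})" for k
        by (simp add: has_vector_derivative_def scaleR_right.sum)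
      then show "((\<lambda>t. \<Sum>k\<in>UNIV. h $ k * (of_real t * \<eta> k (t *\<^sub>R z))) has_vector_derivative D z t h)
          (at t within {0..1})"
        unfolding D_def
        by (auto intro!: derivative_eq_intros has_vector_derivative_of_real simp: algebra_simps)
    qed auto
    finally show ?thesis by simp
  qed
  then have "blinfun_apply (integral (cbox 0 1) (\<lambda>t. Blinfun (D z t))) = (\<lambda>h. \<Sum>k\<in>UNIV. h $ k * \<eta> k z)" ..
  ultimately show "(f has_derivative (\<lambda>h. \<Sum>k\<in>UNIV. h $ k * \<eta> k z)) (at z)"
    by simp
qed

section \<open>Integration by parts\<close>

lemma integral_lborel_translate:
  fixes a :: "'a::euclidean_space" and f :: "'a \<Rightarrow> 'b::{banach, second_countable_topology}"
  assumes [measurable]: "f \<in> borel_measurable borel"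
  shows "(\<integral>x. f (x + a) \<partial>lborel) = (\<integral>x. f x \<partial>lborel)"
proof -
  have "(\<integral>x. f x \<partial>lborel) = (\<integral>x. f x \<partial>distr lborel borel ((+) a))"
    by (simp add: lborel_distr_plus)
  also have "\<dots> = (\<integral>x. f (a + x) \<partial>lborel)"
    by (subst integral_distr) auto
  finally show ?thesis by (simp add: add.commute)
qed

lemma integrable_lborel_translate:
  fixes a :: "'a::euclidean_space" and f :: "'a \<Rightarrow> 'b::{banach, second_countable_topology}"
  assumes "integrable lborel f"
  shows "integrable lborel (\<lambda>x. f (x + a))"
proof -
  have "integrable (distr lborel borel ((+) a)) f"
    using assms by (simp add: lborel_distr_plus)
  then have "integrable lborel (\<lambda>x. f (a + x))"
    by (rule integrable_distr[rotated]) simp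
  then show ?thesis by (simp add: add.commute)
qed

text \<open>Difference quotients of \<open>F\<close> have integral 0 by translation invariance; the
  Lipschitz bound and bounded support dominate them, so the limit has integral 0 as well. An almost
  everywhere derivative suffices, which admits functions cut off along a sphere.\<close>

lemma integral_directional_derivative_eq_0:
  fixes F F' :: "'a::euclidean_space \<Rightarrow> 'b::{banach, second_countable_topology}"
  assumes int: "integrable lborel F"
    and lip: "\<And>x y. norm (F x - F y) \<le> L * norm (x - y)"
    and supp: "\<And>z. F z \<noteq> 0 \<Longrightarrow> norm z \<le> R"
    and der: "AE z in lborel. ((\<lambda>t. F (z + t *\<^sub>R v)) has_vector_derivative F' z) (at 0)"
    and F': "F' \<in> borel_measurable borel"
  shows "integrable lborel F'" and "(\<integral>z. F' z \<partial>lborel) = 0"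
proof -
  \<comment> \<open>The doubled inverse is division by the step
    \<open>h = inverse (real (Suc n))\<close>, in the shape that the limit of the quotients in
    \<open>h\<close> delivers.\<close>
  define s where "s n z = inverse (inverse (real (Suc n))) *\<^sub>R (F (z + inverse (real (Suc n)) *\<^sub>R v) - F z)" for n z
  \<comment> \<open>Since the steps are at most 1, translation along \<open>v\<close> enlarges the
    support by at most \<open>norm v\<close>.\<close>
  define w where "w z = indicator (cball 0 (R + norm v)) z *\<^sub>R (L * norm v)" for z :: 'a
  have [measurable]: "F \<in> borel_measurable borel" using int by simp
  note F'[measurable]
  have [measurable]: "s n \<in> borel_measurable lborel" for n unfolding s_def[abs_def] by measurable
  have w: "integrable lborel w"
    unfolding w_def[abs_def] by (intro borel_integrable_compact) auto
  have lim: "AE z in lborel. (\<lambda>n. s n z) \<longlonglongrightarrow> F' z"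
  proof (rule AE_mp[OF der], rule AE_I2, rule impI)
    fix z assume "((\<lambda>t. F (z + t *\<^sub>R v)) has_vector_derivative F' z) (at 0)"
    then have "((\<lambda>h. norm (F (z + h *\<^sub>R v) - F z - h *\<^sub>R F' z) / norm h) \<longlongrightarrow> 0) (at 0)"
      by (simp add: has_vector_derivative_def has_derivative_at)
    also have "?this \<longleftrightarrow> ((\<lambda>h. norm ((F (z + h *\<^sub>R v) - F z) /\<^sub>R h - F' z)) \<longlongrightarrow> 0) (at 0)"
    proof (intro filterlim_cong refl, unfold eventually_at_filter, intro always_eventually allI impI)
      fix h :: real assume "h \<noteq> 0"
      then have "(F (z + h *\<^sub>R v) - F z) /\<^sub>R h - F' z = (F (z + h *\<^sub>R v) - F z - h *\<^sub>R F' z) /\<^sub>R h"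
        by (simp add: scaleR_diff_right)
      then show "norm (F (z + h *\<^sub>R v) - F z - h *\<^sub>R F' z) / norm h = norm ((F (z + h *\<^sub>R v) - F z) /\<^sub>R h - F' z)"
        by (simp add: divide_inverse_commute)
    qed
    finally have "((\<lambda>h. (F (z + h *\<^sub>R v) - F z) /\<^sub>R h) \<longlongrightarrow> F' z) (at 0)"
      by (simp add: LIM_zero_iff tendsto_norm_zero_iff)
    moreover have "filterlim (\<lambda>n. inverse (real (Suc n))) (at 0) sequentially"
      by (rule filterlim_atI[OF LIMSEQ_inverse_real_of_nat]) auto
    ultimately show "(\<lambda>n. s n z) \<longlonglongrightarrow> F' z"
      unfolding s_def by (rule filterlim_compose)
  qed
  have bound: "AE z in lborel. norm (s n z) \<le> w z" for n
  proof (rule AE_I2)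
    fix z
    define h where "h = inverse (real (Suc n))"
    have h: "0 < h" "h \<le> 1" by (auto simp: h_def field_simps)
    have "norm (F (z + h *\<^sub>R v) - F z) \<le> L * (h * norm v)"
      using lip[of "z + h *\<^sub>R v" z] h by simp
    moreover have s_eq: "s n z = (F (z + h *\<^sub>R v) - F z) /\<^sub>R h"
      by (simp only: s_def h_def)
    ultimately have b: "norm (s n z) \<le> L * norm v"
      using h by (simp add: divide_inverse_commute[symmetric] pos_divide_le_eq mult_ac)
    show "norm (s n z) \<le> w z"
    proof (cases "norm z \<le> R + norm v")
      case False
      have "norm z \<le> norm (z + h *\<^sub>R v) + norm (h *\<^sub>R v)"
        using norm_triangle_ineq4[of "z + h *\<^sub>R v" "h *\<^sub>R v"] by simp
      moreover have "norm (h *\<^sub>R v) \<le> norm v"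
        using h mult_right_mono[of h 1 "norm v"] by simp
      ultimately have "F (z + h *\<^sub>R v) = 0"
        using supp[of "z + h *\<^sub>R v"] False by fastforce
      moreover have "F z = 0" using supp[of z] False norm_ge_zero[of v] by linarith
      ultimately show ?thesis using False by (simp add: s_eq w_def)
    qed (use b in \<open>simp add: w_def\<close>)
  qed
  show "integrable lborel F'"
    by (rule integrable_dominated_convergence[OF _ _ w lim bound]) auto
  have "(\<lambda>n. \<integral>z. s n z \<partial>lborel) \<longlonglongrightarrow> (\<integral>z. F' z \<partial>lborel)"
    by (rule integral_dominated_convergence[OF _ _ w lim bound]) auto
  moreover have "(\<integral>z. s n z \<partial>lborel) = 0" for n
    unfolding s_def
    by (simp add: Bochner_Integration.integral_diff integrable_lborel_translate int integral_lborel_translate)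
  ultimately show "(\<integral>z. F' z \<partial>lborel) = 0"
    by (simp add: LIMSEQ_const_iff)
qed

text \<open>The operator norm of \<open>D x\<close> is at most the sum of the norms of its values on
  the basis, a continuous function bounded on \<open>S\<close>; convexity then permits the mean
  value inequality.\<close>

lemma lipschitz_on_compact_convex:
  fixes f :: "'a::euclidean_space \<Rightarrow> 'b::real_normed_vector"
  assumes S: "compact S" "convex S"
    and f: "\<And>x. x \<in> S \<Longrightarrow> (f has_derivative D x) (at x within S)"
    and D: "\<And>h. continuous_on S (\<lambda>x. D x h)"
  obtains L where "0 \<le> L" "\<And>x y. x \<in> S \<Longrightarrow> y \<in> S \<Longrightarrow> norm (f x - f y) \<le> L * norm (x - y)"
proof -
  have "continuous_on S (\<lambda>x. \<Sum>b\<in>Basis. norm (D x b))"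
    by (intro continuous_intros D)
  then have "bounded ((\<lambda>x. \<Sum>b\<in>Basis. norm (D x b)) ` S)"
    by (intro compact_imp_bounded compact_continuous_image S)
  then obtain L where L: "\<And>x. x \<in> S \<Longrightarrow> norm (\<Sum>b\<in>Basis. norm (D x b)) \<le> L"
    unfolding bounded_iff by blast
  have "norm (f x - f y) \<le> max 0 L * norm (x - y)" if "x \<in> S" "y \<in> S" for x y
  proof (rule differentiable_bound[OF S(2) f _ that])
    fix x assume x: "x \<in> S"
    have "onorm (D x) \<le> (\<Sum>b\<in>Basis. norm (D x b))"
      by (rule onorm_componentwise) (rule has_derivative_bounded_linear[OF f[OF x]])
    then show "onorm (D x) \<le> max 0 L" using L[OF x] unfolding real_norm_def by linarith
  qed auto
  then show thesis by (intro that[of "max 0 L"]) auto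
qed

text \<open>If \<open>x\<close> lies inside and \<open>y\<close> outside, compare \<open>x\<close>
  with its nearest point \<open>p\<close> on the sphere, where \<open>f\<close> vanishes:
  \<open>norm (x - p) = r - norm x\<close>, which is at most \<open>norm (x - y)\<close>. For
  \<open>x = 0\<close> any point of the sphere serves as \<open>p\<close>.\<close>

lemma lipschitz_extend_by_zero:
  fixes f :: "'a::euclidean_space \<Rightarrow> 'b::real_normed_vector"
  assumes r: "0 \<le> r" and L: "0 \<le> L"
    and lip: "\<And>x y. x \<in> cball 0 r \<Longrightarrow> y \<in> cball 0 r \<Longrightarrow> norm (f x - f y) \<le> L * norm (x - y)"
    and zero: "\<And>x. norm x = r \<Longrightarrow> f x = 0"
  shows "norm (indicator (cball 0 r) x *\<^sub>R f x - indicator (cball 0 r) y *\<^sub>R f y) \<le> L * norm (x - y)"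
proof -
  have *: "norm (f x) \<le> L * norm (x - y)" if x: "norm x \<le> r" and y: "r < norm y" for x y
  proof -
    obtain p where p: "norm p = r" "norm (x - p) = r - norm x"
    proof (cases "x = 0")
      case True
      obtain b :: 'a where "b \<in> Basis" using nonempty_Basis by blast
      then show ?thesis using r True by (intro that[of "r *\<^sub>R b"]) auto
    next
      case False
      have "x - (r / norm x) *\<^sub>R x = (1 - r / norm x) *\<^sub>R x" by (simp add: algebra_simps)
      then have "norm (x - (r / norm x) *\<^sub>R x) = \<bar>1 - r / norm x\<bar> * norm x" by simp
      also have "\<dots> = r - norm x" using False x by (simp add: field_simps abs_if)
      finally show ?thesis using False r by (intro that[of "(r / norm x) *\<^sub>R x"]) auto
    qed
    have "norm (f x) \<le> L * norm (x - p)"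
      using lip[of x p] zero[of p] p x by auto
    also have "\<dots> \<le> L * norm (x - y)"
      using p y norm_triangle_ineq2[of y x] L by (intro mult_left_mono) (auto simp: norm_minus_commute)
    finally show ?thesis .
  qed
  show ?thesis
    using lip[of x y] *[of x y] *[of y x] L
    by (auto simp: indicator_def not_le norm_minus_commute)
qed

lemma AE_lborel_not_in_sphere: "AE z in lborel. z \<notin> sphere (a :: 'a::euclidean_space) r"
proof (rule AE_not_in)
  have "sphere a r \<in> null_sets (completion lborel)"
    using negligible_sphere[of a r] by (simp add: negligible_iff_null_sets)
  then show "sphere a r \<in> null_sets lborel"
    by (simp add: null_sets_completion_iff)
qed

text \<open>The function \<open>G k\<close>, equal to \<open>cnj f * \<eta> k * p\<close>, vanishes
  on the sphere of radius \<open>r\<close> because \<open>p\<close> does, so its extension by zero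
  is Lipschitz and its directional derivatives have integral 0. Combining the real and imaginary
  directions of each coordinate into the Cauchy-Riemann operator and summing over \<open>k\<close>
  gives the identity.\<close>

lemma bergman_integration_by_parts:
  fixes \<eta> :: "'n::finite \<Rightarrow> complex ^ 'n \<Rightarrow> complex"
  assumes r: "0 \<le> r" "r < 1"
    and f: "\<And>z. z \<in> ball 0 1 \<Longrightarrow> (f has_derivative (\<lambda>h. \<Sum>k\<in>UNIV. h $ k * \<eta> k z)) (at z)"
    and hol: "\<And>k. holomorphic_Cn (\<eta> k) (ball 0 1)"
  shows "(\<integral>z. indicator (cball 0 r) z *\<^sub>R ((\<Sum>k\<in>UNIV. (cmod (\<eta> k z))\<^sup>2) *
            ((1 - (norm z)\<^sup>2) powr \<gamma> - (1 - r\<^sup>2) powr \<gamma>)) \<partial>lborel)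
        = \<gamma> * ball_integral (\<gamma> - 1) r (\<lambda>z. Re (cnj (f z) * (\<Sum>k\<in>UNIV. z $ k * \<eta> k z)))"
proof -
  let ?S = "cball (0 :: complex ^ 'n) r"
  define p where "p z = (1 - (norm z)\<^sup>2) powr \<gamma> - (1 - r\<^sup>2) powr \<gamma>" for z :: "complex ^ 'n"
  define q where "q z = (1 - (norm z)\<^sup>2) powr (\<gamma> - 1)" for z :: "complex ^ 'n"
  define G where "G k z = cnj (f z) * (\<eta> k z * of_real (p z))" for k z
  define DG where "DG k z h = cnj (f z) * (\<eta> k z * of_real (\<gamma> * q z * - (2 * (z \<bullet> h)))
      + (\<Sum>j\<in>UNIV. h $ j * partial_deriv j (\<eta> k) z) * of_real (p z))
      + cnj (\<Sum>j\<in>UNIV. h $ j * \<eta> j z) * (\<eta> k z * of_real (p z))" for k z h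
  have S: "?S \<subseteq> ball 0 1" using r by auto
  have cf: "continuous_on ?S f"
    using S by (intro continuous_at_imp_continuous_on ballI has_derivative_continuous[OF f]) auto
  have c\<eta>: "continuous_on ?S (\<eta> k)" for k
    using continuous_on_subset[OF holomorphic_Cn_imp_continuous_on[OF hol] S] .
  have cd: "continuous_on ?S (partial_deriv j (\<eta> k))" for j k
    using continuous_on_subset[OF continuous_on_partial_deriv[OF hol open_ball] S] .
  have pos: "0 < 1 - (norm z)\<^sup>2" if "z \<in> ball 0 1" for z :: "complex ^ 'n"
    using that by (intro one_minus_norm_sq_pos) auto
  have cp: "continuous_on ?S p" "continuous_on ?S q"
    unfolding p_def q_def using pos[OF subsetD[OF S]] by (auto intro!: continuous_intros simp: less_le)
  have dp: "(p has_derivative (\<lambda>h. \<gamma> * q z * - (2 * (z \<bullet> h)))) (at z)" if z: "z \<in> ball 0 1" for z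
  proof -
    have "((\<lambda>x. (1 - x \<bullet> x) powr \<gamma>) has_derivative (\<lambda>h. \<gamma> * (1 - z \<bullet> z) powr (\<gamma> - 1) * - (2 * (z \<bullet> h)))) (at z)"
      using pos[OF z]
      by (auto intro!: derivative_eq_intros simp: dot_square_norm inner_commute powr_diff field_simps fun_eq_iff)
    from has_derivative_diff[OF this has_derivative_const[of "(1 - r\<^sup>2) powr \<gamma>"]] show ?thesis
      unfolding p_def[abs_def] q_def by (simp add: dot_square_norm)
  qed
  have dG: "(G k has_derivative DG k z) (at z)" if z: "z \<in> ball 0 1" for k z
    unfolding G_def[abs_def] DG_def
    by (intro has_derivative_mult has_derivative_cnj f[OF z] has_derivative_of_real dp[OF z]
        holomorphic_Cn_has_derivative[OF hol z])
  have cDG: "continuous_on ?S (\<lambda>z. DG k z h)" for k h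
    unfolding DG_def by (intro continuous_intros cf c\<eta> cd cp)
  have cG: "continuous_on ?S (G k)" for k
    unfolding G_def by (intro continuous_intros cf c\<eta> cp)
  have parts: "integrable lborel (\<lambda>z. indicator ?S z *\<^sub>R DG k z v)"
      "(\<integral>z. indicator ?S z *\<^sub>R DG k z v \<partial>lborel) = 0" for k v
  proof -
    obtain L where L: "0 \<le> L"
      and lip: "\<And>x y. x \<in> ?S \<Longrightarrow> y \<in> ?S \<Longrightarrow> norm (G k x - G k y) \<le> L * norm (x - y)"
      by (rule lipschitz_on_compact_convex[where f = "G k" and D = "DG k", OF compact_cball convex_cball _ cDG])
        (use r in \<open>auto intro!: has_derivative_at_withinI dG\<close>)
    have zero: "G k x = 0" if "norm x = r" for x
      using that by (simp add: G_def p_def)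
    \<comment> \<open>Off the sphere, a null set, the extension coincides near \<open>z\<close>
      either with \<open>G k\<close> or with 0.\<close>
    have der: "AE z in lborel. ((\<lambda>t. indicator ?S (z + t *\<^sub>R v) *\<^sub>R G k (z + t *\<^sub>R v))
        has_vector_derivative indicator ?S z *\<^sub>R DG k z v) (at 0)"
      using AE_lborel_not_in_sphere[of "0 :: complex ^ 'n" r]
    proof eventually_elim
      case (elim z)
      have line: "continuous_on UNIV (\<lambda>t. z + t *\<^sub>R v)" by (intro continuous_intros)
      show ?case
      proof (cases "norm z < r")
        case True
        have "((\<lambda>t. z + t *\<^sub>R v) has_derivative (\<lambda>t. t *\<^sub>R v)) (at 0)"
          by (auto intro!: derivative_eq_intros)
        then have "((\<lambda>t. G k (z + t *\<^sub>R v)) has_derivative (\<lambda>t. DG k z (t *\<^sub>R v))) (at 0)"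
          by (rule has_derivative_compose) (use dG True r in auto)
        then have "((\<lambda>t. G k (z + t *\<^sub>R v)) has_vector_derivative DG k z v) (at 0)"
          using dG[of z k] True r
          by (simp add: has_vector_derivative_def linear_scale[OF has_derivative_linear])
        then have "((\<lambda>t. indicator ?S (z + t *\<^sub>R v) *\<^sub>R G k (z + t *\<^sub>R v)) has_vector_derivative DG k z v) (at 0)"
          by (rule has_vector_derivative_transform_within_open[OF _ open_vimage[OF open_ball line, of 0 r]])
            (use True in auto)
        with True show ?thesis by simp
      next
        case False
        with elim have "z \<notin> ?S" by auto
        then have "((\<lambda>t. indicator ?S (z + t *\<^sub>R v) *\<^sub>R G k (z + t *\<^sub>R v)) has_vector_derivative 0) (at 0)"
          by (intro has_vector_derivative_transform_within_open[OF has_vector_derivative_const[of 0]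
                open_vimage[OF open_Compl[OF closed_cball] line, of 0 r]]) auto
        with \<open>z \<notin> ?S\<close> show ?thesis by simp
      qed
    qed
    note * = borel_integrable_compact[OF compact_cball cG]
      lipschitz_extend_by_zero[OF r(1) L lip zero] _ der
      borel_measurable_continuous_on_indicator[OF _ cDG]
    show "integrable lborel (\<lambda>z. indicator ?S z *\<^sub>R DG k z v)"
      by (rule integral_directional_derivative_eq_0(1)[OF *, where R = r]) (auto simp: indicator_def split: if_splits)
    show "(\<integral>z. indicator ?S z *\<^sub>R DG k z v \<partial>lborel) = 0"
      by (rule integral_directional_derivative_eq_0(2)[OF *, where R = r]) (auto simp: indicator_def split: if_splits)
  qed
  \<comment> \<open>\<open>\<partial>/\<partial>x\<^sub>k + \<i> \<partial>/\<partial>y\<^sub>k\<close> annihilates the holomorphic factor \<open>\<eta> k\<close>.\<close>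
  have dbar: "DG k z (axis k 1) + \<i> * DG k z (axis k \<i>)
      = 2 * (of_real ((cmod (\<eta> k z))\<^sup>2 * p z) - of_real (\<gamma> * q z) * (cnj (f z) * (z $ k * \<eta> k z)))" for k z
  proof -
    have sum_axis: "(\<Sum>j\<in>UNIV. axis k w $ j * c j) = w * c k" for w and c :: "'n \<Rightarrow> complex"
      by (simp add: axis_def if_distribR if_distrib[of "\<lambda>x. x * _"] cong: if_cong)
    have inner: "z \<bullet> axis k 1 = Re (z $ k)" "z \<bullet> axis k \<i> = Im (z $ k)"
      by (simp_all add: inner_axis inner_complex_def)
    have "z $ k * \<eta> k z = (of_real (Re (z $ k)) + \<i> * of_real (Im (z $ k))) * \<eta> k z"
      by (simp flip: complex_eq)
    then show ?thesis
      unfolding DG_def sum_axis inner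
      by (simp only: of_real_mult complex_norm_square) (simp add: algebra_simps)
  qed
  let ?T = "\<lambda>k z. indicator ?S z *\<^sub>R DG k z (axis k 1) + \<i> * (indicator ?S z *\<^sub>R DG k z (axis k \<i>))"
  have intT: "integrable lborel (?T k)" "(\<integral>z. ?T k z \<partial>lborel) = 0" for k
    using parts by (auto simp del: mult_scaleR_right)
  have "(\<integral>z. (\<Sum>k\<in>UNIV. ?T k z) \<partial>lborel) = 0"
    by (subst Bochner_Integration.integral_sum) (simp_all only: intT sum.neutral_const)
  moreover have "integrable lborel (\<lambda>z. \<Sum>k\<in>UNIV. ?T k z)"
    by (intro Bochner_Integration.integrable_sum intT)
  ultimately have "(\<integral>z. Re (\<Sum>k\<in>UNIV. ?T k z) \<partial>lborel) = 0"
    by (subst integral_Re) auto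
  moreover have "Re (\<Sum>k\<in>UNIV. ?T k z) = 2 * (indicator ?S z *\<^sub>R ((\<Sum>k\<in>UNIV. (cmod (\<eta> k z))\<^sup>2) * p z)
     - \<gamma> * (indicator ?S z *\<^sub>R (Re (cnj (f z) * (\<Sum>k\<in>UNIV. z $ k * \<eta> k z)) * q z)))" for z
  proof (cases "z \<in> ?S")
    case True
    then have "(\<Sum>k\<in>UNIV. ?T k z) = (\<Sum>k\<in>UNIV. DG k z (axis k 1) + \<i> * DG k z (axis k \<i>))"
      by simp
    also have "\<dots> = 2 * (of_real ((\<Sum>k\<in>UNIV. (cmod (\<eta> k z))\<^sup>2) * p z)
        - of_real (\<gamma> * q z) * (cnj (f z) * (\<Sum>k\<in>UNIV. z $ k * \<eta> k z)))"
      unfolding dbar by (simp add: sum_subtractf sum_distrib_left sum_distrib_right)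
    finally show ?thesis
      using True by (simp del: complex_cnj_mult)
  qed simp
  moreover have "integrable lborel (\<lambda>z. indicator ?S z *\<^sub>R ((\<Sum>k\<in>UNIV. (cmod (\<eta> k z))\<^sup>2) * p z))"
    by (intro borel_integrable_compact continuous_intros compact_cball c\<eta> cp)
  moreover have "integrable lborel (\<lambda>z. indicator ?S z *\<^sub>R (Re (cnj (f z) * (\<Sum>k\<in>UNIV. z $ k * \<eta> k z)) * q z))"
    by (intro borel_integrable_compact continuous_intros compact_cball c\<eta> cp cf)
  ultimately show ?thesis
    by (simp add: ball_integral_def p_def q_def)
qed

section \<open>Exhaustion of the unit ball\<close>

lemma weighted_borel_measurable:
  assumes "continuous_on (ball 0 1) u"
  shows "(\<lambda>z :: complex ^ 'n::finite. ennreal (u z * (1 - (norm z)\<^sup>2) powr \<alpha>) * indicator (ball 0 1) z) \<in> borel_measurable borel"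
proof -
  have "(\<lambda>z :: complex ^ 'n. ennreal (indicator (ball 0 1) z *\<^sub>R (u z * (1 - (norm z)\<^sup>2) powr \<alpha>))) \<in> borel_measurable borel"
    by (intro measurable_compose[OF borel_measurable_continuous_on_indicator measurable_ennreal]
        continuous_on_weight assms) auto
  also have "(\<lambda>z :: complex ^ 'n. ennreal (indicator (ball 0 1) z *\<^sub>R (u z * (1 - (norm z)\<^sup>2) powr \<alpha>))) =
      (\<lambda>z. ennreal (u z * (1 - (norm z)\<^sup>2) powr \<alpha>) * indicator (ball 0 1) z)"
    by (auto simp: indicator_def)
  finally show ?thesis .
qed

definition radius :: "nat \<Rightarrow> real" where "radius n = 1 - inverse (real (Suc n))"

lemma radius_nonneg: "0 \<le> radius n" and radius_less_1: "radius n < 1"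
  by (auto simp: radius_def field_simps)

lemma radius_mono: "m \<le> n \<Longrightarrow> radius m \<le> radius n"
  by (auto simp: radius_def field_simps)

lemma radius_LIMSEQ: "radius \<longlonglongrightarrow> 1"
  using tendsto_diff[OF tendsto_const[of 1] LIMSEQ_inverse_real_of_nat] by (simp add: radius_def[abs_def])

lemma eventually_less_radius: "x < 1 \<Longrightarrow> \<forall>\<^sub>F n in sequentially. x < radius n"
  using order_tendstoD(1)[OF radius_LIMSEQ] .

text \<open>Monotone convergence with a kernel that may vary with \<open>n\<close>, as needed for
  the weight from integration by parts, which depends on the radius. Both the kernels and the balls
  increase, hence so do the integrands.\<close>

lemma exhaustion_LIMSEQ:
  fixes u K :: "complex ^ 'n::finite \<Rightarrow> real"
  assumes u: "continuous_on (ball 0 1) u" "\<And>z. z \<in> ball 0 1 \<Longrightarrow> 0 \<le> u z"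
    and k: "\<And>n. continuous_on (cball 0 (radius n)) (k n)" "\<And>n z. z \<in> cball 0 (radius n) \<Longrightarrow> 0 \<le> k n z"
      "\<And>n z. z \<in> cball 0 (radius n) \<Longrightarrow> k n z \<le> k (Suc n) z"
      "\<And>z. z \<in> ball 0 1 \<Longrightarrow> (\<lambda>n. k n z) \<longlonglongrightarrow> K z"
  shows "(\<lambda>n. ennreal (\<integral>z. indicator (cball 0 (radius n)) z *\<^sub>R (u z * k n z) \<partial>lborel))
           \<longlonglongrightarrow> (\<integral>\<^sup>+ z \<in> ball 0 1. ennreal (u z * K z) \<partial>lborel)"
proof -
  define g where "g n z = indicator (cball 0 (radius n)) z *\<^sub>R (u z * k n z)" for n z
  have sub: "cball 0 (radius n) \<subseteq> ball (0 :: complex ^ 'n) 1" for n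
    using radius_less_1[of n] by auto
  have int: "integrable lborel (g n)" for n
    unfolding g_def[abs_def]
    by (intro borel_integrable_compact continuous_intros k continuous_on_subset[OF u(1) sub]) auto
  have nonneg: "0 \<le> g n z" for n z
    using u(2)[of z] k(2)[of z n] radius_less_1[of n] by (simp add: g_def indicator_def)
  have "ennreal (\<integral>z. g n z \<partial>lborel) = (\<integral>\<^sup>+ z. ennreal (g n z) \<partial>lborel)" for n
    by (rule nn_integral_eq_integral[OF int, symmetric]) (simp add: nonneg)
  moreover have "(\<lambda>n. \<integral>\<^sup>+ z. ennreal (g n z) \<partial>lborel) \<longlonglongrightarrow> (\<integral>\<^sup>+ z. ennreal (u z * K z) * indicator (ball 0 1) z \<partial>lborel)"
  proof (rule nn_integral_LIMSEQ)
    have "g n z \<le> g (Suc n) z" for n z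
    proof (cases "z \<in> cball 0 (radius n)")
      case True
      then have "z \<in> cball 0 (radius (Suc n))" using radius_mono[of n "Suc n"] by auto
      with True show ?thesis
        using k(3)[OF True] u(2)[OF subsetD[OF sub True]] by (auto simp: g_def intro!: mult_left_mono)
    next
      case False
      then show ?thesis using nonneg[of "Suc n" z] by (simp add: g_def)
    qed
    then show "incseq (\<lambda>n z. ennreal (g n z))"
      by (intro incseq_SucI le_funI ennreal_leI)
    show "(\<lambda>z. ennreal (g n z)) \<in> borel_measurable lborel" for n
      using int by simp
    show "(\<lambda>n. ennreal (g n z)) \<longlonglongrightarrow> ennreal (u z * K z) * indicator (ball 0 1) z" for z
    proof (cases "norm z < 1")
      case True
      have "\<forall>\<^sub>F n in sequentially. u z * k n z = g n z"
        using eventually_less_radius[OF True] by eventually_elim (auto simp: g_def)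
      then have "(\<lambda>n. g n z) \<longlonglongrightarrow> u z * K z"
        using True by (intro Lim_transform_eventually[OF tendsto_mult[OF tendsto_const k(4)]]) auto
      with True show ?thesis by (simp add: tendsto_ennrealI)
    next
      case False
      then have "g n z = 0" for n using radius_less_1[of n] by (simp add: g_def)
      with False show ?thesis by simp
    qed
  qed
  ultimately show ?thesis by (simp add: g_def)
qed

lemma ball_integral_LIMSEQ:
  fixes u :: "complex ^ 'n::finite \<Rightarrow> real"
  assumes "continuous_on (ball 0 1) u" "\<And>z. z \<in> ball 0 1 \<Longrightarrow> 0 \<le> u z"
  shows "(\<lambda>n. ennreal (ball_integral \<alpha> (radius n) u)) \<longlonglongrightarrow> weighted_integral \<alpha> u"
  unfolding ball_integral_def weighted_integral_def
proof (rule exhaustion_LIMSEQ[OF assms, where K = "\<lambda>z. (1 - (norm z)\<^sup>2) powr \<alpha>"])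
  show "continuous_on (cball 0 (radius n)) (\<lambda>z :: complex ^ 'n. (1 - (norm z)\<^sup>2) powr \<alpha>)" for n
    using continuous_on_weight[of "cball (0 :: complex ^ 'n) (radius n)" "\<lambda>_. 1" \<alpha>] radius_less_1[of n]
    by (simp add: subset_iff)
qed auto

lemma ball_integral_diff:
  fixes u v :: "complex ^ 'n::finite \<Rightarrow> real"
  assumes "continuous_on (ball 0 1) u" "continuous_on (ball 0 1) v" "r < 1"
  shows "ball_integral \<alpha> r (\<lambda>z. u z - v z) = ball_integral \<alpha> r u - ball_integral \<alpha> r v"
  unfolding ball_integral_def
    Bochner_Integration.integral_diff[OF ball_integrable[OF assms(1,3)] ball_integrable[OF assms(2,3)], symmetric]
  by (simp add: algebra_simps)

lemma ball_integral_nonneg: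
  assumes "\<And>z. z \<in> cball 0 r \<Longrightarrow> 0 \<le> u z"
  shows "0 \<le> ball_integral \<alpha> r u"
  unfolding ball_integral_def
  by (rule Bochner_Integration.integral_nonneg) (use assms in \<open>auto simp: indicator_def\<close>)

lemma ball_integral_mono_radius:
  fixes u :: "complex ^ 'n::finite \<Rightarrow> real"
  assumes u: "continuous_on (ball 0 1) u" "\<And>z. z \<in> ball 0 1 \<Longrightarrow> 0 \<le> u z" and r: "r \<le> s" "s < 1"
  shows "ball_integral \<alpha> r u \<le> ball_integral \<alpha> s u"
  unfolding ball_integral_def
proof (rule integral_mono)
  show "indicator (cball 0 r) z *\<^sub>R (u z * (1 - (norm z)\<^sup>2) powr \<alpha>)
      \<le> indicator (cball 0 s) z *\<^sub>R (u z * (1 - (norm z)\<^sup>2) powr \<alpha>)" for z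
    using r u(2)[of z] by (auto simp: indicator_def)
qed (use ball_integrable[OF u(1)] r in auto)

text \<open>A nonnegative continuous function with integral 0 vanishes on the closure of the open
  ball, and the weight is positive there since \<open>r < 1\<close>.\<close>

lemma ball_integral_eq_0_imp:
  fixes u :: "complex ^ 'n::finite \<Rightarrow> real"
  assumes u: "continuous_on (ball 0 1) u" "\<And>z. z \<in> ball 0 1 \<Longrightarrow> 0 \<le> u z" and r: "0 < r" "r < 1"
    and 0: "ball_integral \<alpha> r u = 0" and z: "z \<in> cball 0 r"
  shows "u z = 0"
proof -
  let ?g = "\<lambda>z :: complex ^ 'n. u z * (1 - (norm z)\<^sup>2) powr \<alpha>"
  have sub: "cball 0 r \<subseteq> ball (0 :: complex ^ 'n) 1" using r by auto
  have cont: "continuous_on (cball 0 r) ?g"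
    by (intro continuous_on_weight continuous_on_subset[OF u(1)] sub)
  have meas: "emeasure lborel (cball (0 :: complex ^ 'n) r) = emeasure lborel (ball (0 :: complex ^ 'n) r)"
    using content_cball_conv_ball[of "0 :: complex ^ 'n" r]
      emeasure_lborel_ball_finite[of "0 :: complex ^ 'n" r] emeasure_lborel_cball_finite[of "0 :: complex ^ 'n" r]
    by (simp add: emeasure_eq_ennreal_measure less_top)
  have pos: "0 < emeasure lborel (ball (0 :: complex ^ 'n) r)"
    using content_ball_pos[OF r(1), of "0 :: complex ^ 'n"] by (auto simp: measure_def zero_less_iff_neq_zero)
  have "set_integrable lborel (cball 0 r) ?g"
    using ball_integrable[OF u(1) r(2)] by (simp add: set_integrable_def)
  from set_borel_integral_eq_integral[OF this] have "(?g has_integral 0) (closure (ball 0 r))"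
    using 0 r by (simp add: has_integral_iff ball_integral_def set_lebesgue_integral_def)
  moreover have "0 \<le> ?g x" if "x \<in> ball 0 r" for x
    using that r u(2)[of x] by simp
  moreover have "emeasure lborel (ball (0 :: complex ^ 'n) r) < \<infinity>"
    using emeasure_lborel_ball_finite by (simp add: less_top)
  moreover have "closure (ball (0 :: complex ^ 'n) r) = cball 0 r"
    using r by simp
  ultimately have "?g z = 0"
    using has_integral_0_closure_imp_0[of "ball 0 r" ?g z] cont meas pos z by simp
  then show ?thesis using z r one_minus_norm_sq_pos[of z] by simp
qed

section \<open>The normalized primitive\<close>

text \<open>The results on the unit circle require holomorphy on a disc of radius greater than
  1.\<close>

lemma slice_holomorphic:
  fixes f :: "complex ^ 'n::finite \<Rightarrow> complex"
  assumes f: "holomorphic_Cn f (ball 0 1)" and z: "z \<in> ball 0 1"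
  obtains R where "1 < R" "(\<lambda>w. f (w *s z)) holomorphic_on ball 0 R"
    "\<And>w. w \<in> ball 0 R \<Longrightarrow> w *s z \<in> ball 0 1"
    "\<And>w. w \<in> ball 0 R \<Longrightarrow> deriv (\<lambda>w. f (w *s z)) w = (\<Sum>k\<in>UNIV. z $ k * partial_deriv k f (w *s z))"
proof -
  \<comment> \<open>The largest disc that the slice maps into the unit ball; at \<open>z = 0\<close>
    the slice is constant and any radius above 1 would do.\<close>
  define R where "R = (if z = 0 then 2 else 1 / norm z)"
  have in_ball: "w *s z \<in> ball 0 1" if "w \<in> ball 0 R" for w
    using that by (auto simp: R_def field_simps split: if_splits)
  have der: "((\<lambda>w. f (w *s z)) has_field_derivative (\<Sum>k\<in>UNIV. z $ k * partial_deriv k f (w *s z))) (at w)"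
    if "w \<in> ball 0 R" for w
    using holomorphic_Cn_slice_derivative[OF f, of 0 w z] in_ball[OF that] by simp
  show thesis
  proof (rule that[of R])
    show "1 < R" using z by (auto simp: R_def field_simps)
    show "(\<lambda>w. f (w *s z)) holomorphic_on ball 0 R"
      unfolding holomorphic_on_open[OF open_ball] using der by blast
  qed (use in_ball der in \<open>auto intro: DERIV_imp_deriv\<close>)
qed

text \<open>Expanding the square leaves the cross term \<open>Re (2 * c * cnj f)\<close>, which the
  mean value property annihilates because \<open>f 0 = 0\<close>.\<close>

lemma circle_integral_add_const:
  fixes f :: "complex ^ 'n::finite \<Rightarrow> complex"
  assumes f: "holomorphic_Cn f (ball 0 1)" "f 0 = 0" and z: "z \<in> ball 0 1"
  shows "circle_integral (\<lambda>z. (cmod (f z + c))\<^sup>2 - (cmod (f z))\<^sup>2) z = 2 * pi * (cmod c)\<^sup>2"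
proof -
  obtain R where R: "1 < R" "(\<lambda>w. f (w *s z)) holomorphic_on ball 0 R"
    using slice_holomorphic[OF f(1) z] by metis
  have "((\<lambda>t. cnj (f (cis t *s z))) has_integral 0) {0..2*pi}"
    using fourier_coefficient_holomorphic[OF R(2,1), of 0] f(2) by simp
  from has_integral_mult_right[OF this, of "2 * c"]
  have "((\<lambda>t. 2 * c * cnj (f (cis t *s z))) has_integral 0) {0..2*pi}" by simp
  from has_integral_linear[OF this bounded_linear_Re]
  have "((\<lambda>t. Re (2 * c * cnj (f (cis t *s z)))) has_integral 0) {0..2*pi}" by (simp add: o_def)
  from has_integral_add[OF this has_integral_const_real[of "(cmod c)\<^sup>2"]]
  have "((\<lambda>t. Re (2 * c * cnj (f (cis t *s z))) + (cmod c)\<^sup>2) has_integral 2 * pi * (cmod c)\<^sup>2) {0..2*pi}"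
    by simp
  moreover have "Re (2 * c * cnj a) + (cmod c)\<^sup>2 = (cmod (a + c))\<^sup>2 - (cmod a)\<^sup>2" for a
    unfolding cmod_power2 by (simp add: power2_eq_square algebra_simps)
  ultimately show ?thesis
    by (simp add: circle_integral_def integral_unique)
qed

lemma ball_integral_nonneg_if_circle_integral_nonneg:
  fixes u :: "complex ^ 'n::finite \<Rightarrow> real"
  assumes u: "continuous_on (ball 0 1) u" and r: "r < 1"
    and "\<And>z. z \<in> ball 0 1 \<Longrightarrow> 0 \<le> circle_integral u z"
  shows "0 \<le> ball_integral \<alpha> r u"
proof -
  have "0 \<le> ball_integral \<alpha> r (circle_integral u)"
    by (rule ball_integral_nonneg) (use assms in auto)
  then have "0 \<le> (2 * pi) * ball_integral \<alpha> r u"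
    by (simp add: ball_integral_circle_integral[OF u r])
  then show ?thesis
    by (subst (asm) zero_le_mult_iff) (use pi_gt_zero in linarith)
qed

lemma zero_derivative_imp_constant_on_ball:
  fixes f g :: "'a::euclidean_space \<Rightarrow> 'b::real_normed_vector"
  assumes "\<And>z. z \<in> ball 0 1 \<Longrightarrow> (f has_derivative D z) (at z)" "\<And>z. z \<in> ball 0 1 \<Longrightarrow> (g has_derivative D z) (at z)"
  obtains c where "\<And>z. z \<in> ball 0 1 \<Longrightarrow> g z = f z + c"
proof -
  have "((\<lambda>z. g z - f z) has_derivative (\<lambda>h. 0)) (at z within ball 0 1)" if "z \<in> ball 0 1" for z
    using has_derivative_diff[OF assms(2,1)[OF that]] by (auto intro: has_derivative_at_withinI)
  from has_derivative_zero_constant[OF convex_ball this]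
  obtain c where "\<And>z. z \<in> ball 0 1 \<Longrightarrow> g z - f z = c" by blast
  then show thesis by (intro that[of c]) (simp add: algebra_simps)
qed

section \<open>Inequality, minimality and the equality case\<close>

locale bergman_primitive =
  fixes \<gamma> :: real and \<eta> :: "'n::finite \<Rightarrow> complex ^ 'n \<Rightarrow> complex" and f :: "complex ^ 'n \<Rightarrow> complex"
  assumes gamma_pos: "0 < \<gamma>"
    and form: "closed_bergman_form \<gamma> \<eta>"
    and f_derivative: "z \<in> ball 0 1 \<Longrightarrow> (f has_derivative (\<lambda>h. \<Sum>k\<in>UNIV. h $ k * \<eta> k z)) (at z)"
    and f_0: "f 0 = 0"
begin

abbreviation "energy \<equiv> \<lambda>z. \<Sum>k\<in>UNIV. (cmod (\<eta> k z))\<^sup>2"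

definition "radial = (\<lambda>z. Re (cnj (f z) * (\<Sum>k\<in>UNIV. z $ k * \<eta> k z)))"

text \<open>Not nonnegative pointwise in general; only its circle integrals are, so sign arguments
  must go through averages.\<close>

definition "excess = (\<lambda>z. radial z - (cmod (f z))\<^sup>2)"

lemma eta_holomorphic: "holomorphic_Cn (\<eta> k) (ball 0 1)"
  using form by (simp add: closed_bergman_form_def bergman_space_def)

lemma f_holomorphic: "holomorphic_Cn f (ball 0 1)"
  unfolding holomorphic_Cn_def
proof (intro ballI exI conjI allI)
  fix z assume "z \<in> ball (0 :: complex ^ 'n) 1"
  then show "(f has_derivative (\<lambda>h. \<Sum>k\<in>UNIV. h $ k * \<eta> k z)) (at z)" by (rule f_derivative)
qed (simp add: sum_distrib_left mult.assoc)

lemma f_partial_deriv: "z \<in> ball 0 1 \<Longrightarrow> partial_deriv k f z = \<eta> k z"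
  by (rule holomorphic_Cn_partial_deriv_eqI[OF f_derivative])

lemmas continuous = holomorphic_Cn_imp_continuous_on[OF f_holomorphic]
  holomorphic_Cn_imp_continuous_on[OF eta_holomorphic]

lemma continuous_sq: "continuous_on (ball 0 1) (\<lambda>z. (cmod (f z))\<^sup>2)"
  by (intro continuous_intros continuous)

lemma continuous_radial: "continuous_on (ball 0 1) radial"
  unfolding radial_def
  by (intro continuous_intros continuous)

lemma continuous_excess: "continuous_on (ball 0 1) excess"
  unfolding excess_def by (intro continuous_on_diff continuous_radial continuous_sq)

text \<open>On the slice through \<open>z\<close> the radial derivative of \<open>f\<close> becomes
  \<open>w\<close> times the derivative in \<open>w\<close>, which reduces both claims to
  \<open>circle_integral_rotation_minus_id\<close>.\<close>

lemma circle_integral_excess: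
  assumes z: "z \<in> ball 0 1"
  shows "0 \<le> circle_integral excess z"
    and "circle_integral excess z = 0 \<Longrightarrow> cmod w \<le> 1 \<Longrightarrow> f (w *s z) = w * f z"
proof -
  obtain R where R: "1 < R" "(\<lambda>w. f (w *s z)) holomorphic_on ball 0 R"
    and in_ball: "\<And>w. w \<in> ball 0 R \<Longrightarrow> w *s z \<in> ball 0 1"
    and der: "\<And>w. w \<in> ball 0 R \<Longrightarrow> deriv (\<lambda>w. f (w *s z)) w = (\<Sum>k\<in>UNIV. z $ k * partial_deriv k f (w *s z))"
    by (rule slice_holomorphic[OF f_holomorphic z]) (rule that; blast)
  have "excess (w *s z) = Re (cnj (f (w *s z)) * (w * deriv (\<lambda>w. f (w *s z)) w - f (w *s z)))"
    if "w \<in> ball 0 R" for w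
  proof -
    have "w * deriv (\<lambda>w. f (w *s z)) w = (\<Sum>k\<in>UNIV. (w *s z) $ k * \<eta> k (w *s z))"
      using f_partial_deriv[OF in_ball[OF that]] by (simp add: der[OF that] sum_distrib_left mult_ac)
    then show ?thesis
      unfolding excess_def radial_def
      by (simp add: right_diff_distrib cmod_power2) (simp add: power2_eq_square)
  qed
  then have eq: "circle_integral excess z =
    integral {0..2*pi} (\<lambda>t. Re (cnj (f (cis t *s z)) * (cis t * deriv (\<lambda>w. f (w *s z)) (cis t) - f (cis t *s z))))"
    using R(1) unfolding circle_integral_def by (intro integral_cong) simp
  note * = circle_integral_rotation_minus_id[OF R(2,1), folded eq]
  show "0 \<le> circle_integral excess z"
    by (rule *(1)) (simp add: f_0)
  assume "circle_integral excess z = 0" "cmod w \<le> 1"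
  have "f (v *s z) = v * deriv (\<lambda>w. f (w *s z)) 0" if "cmod v \<le> 1" for v
    using *(2)[of v] R(1) that \<open>circle_integral excess z = 0\<close> by (simp add: f_0)
  \<comment> \<open>The instance at 1 identifies the derivative of the slice at 0 with
    \<open>f z\<close>.\<close>
  from this[of w] this[of 1] \<open>cmod w \<le> 1\<close> show "f (w *s z) = w * f z" by simp
qed

lemma ball_integral_radial:
  assumes "r < 1"
  shows "ball_integral \<alpha> r radial = ball_integral \<alpha> r (\<lambda>z. (cmod (f z))\<^sup>2) + ball_integral \<alpha> r excess"
  using ball_integral_diff[OF continuous_radial continuous_sq assms] by (simp add: excess_def)

lemma ball_integral_excess_nonneg: "r < 1 \<Longrightarrow> 0 \<le> ball_integral \<alpha> r excess"
  by (rule ball_integral_nonneg_if_circle_integral_nonneg[OF continuous_excess _ circle_integral_excess(1)])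

lemma sq_LIMSEQ:
  "(\<lambda>n. ennreal (ball_integral \<alpha> (radius n) (\<lambda>z. (cmod (f z))\<^sup>2))) \<longlonglongrightarrow> weighted_integral \<alpha> (\<lambda>z. (cmod (f z))\<^sup>2)"
  by (rule ball_integral_LIMSEQ[OF continuous_sq]) simp

text \<open>As \<open>radial\<close> may change sign, monotone convergence does not apply to it
  directly. Integration by parts replaces it by \<open>energy\<close> against kernels that are
  nonnegative and increase to the full weight.\<close>

lemma radial_LIMSEQ:
  "(\<lambda>n. ennreal (ball_integral (\<gamma> - 1) (radius n) radial)) \<longlonglongrightarrow> ennreal (1 / \<gamma>) * weighted_integral \<gamma> energy"
proof -
  let ?k = "\<lambda>n z. (1 - (norm z)\<^sup>2) powr \<gamma> - (1 - (radius n)\<^sup>2) powr \<gamma>"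
  have "(\<lambda>n. ennreal (\<integral>z. indicator (cball 0 (radius n)) z *\<^sub>R (energy z * ?k n z) \<partial>lborel))
      \<longlonglongrightarrow> weighted_integral \<gamma> energy"
    unfolding weighted_integral_def
  proof (rule exhaustion_LIMSEQ)
    show "continuous_on (ball 0 1) energy" by (intro continuous_intros continuous)
    show "continuous_on (cball 0 (radius n)) (?k n :: complex ^ 'n \<Rightarrow> real)" for n
      using continuous_on_weight[of "cball (0 :: complex ^ 'n) (radius n)" "\<lambda>_. 1" \<gamma>] radius_less_1[of n]
      by (intro continuous_on_diff) (auto simp: subset_iff)
    show "0 \<le> ?k n z" if "z \<in> cball 0 (radius n)" for n and z :: "complex ^ 'n"
      using that gamma_pos radius_less_1[of n] radius_nonneg[of n]
      by (auto intro!: powr_mono2 power_mono simp: power_le_one)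
    show "?k n z \<le> ?k (Suc n) z" for n and z :: "complex ^ 'n"
      using gamma_pos radius_less_1[of "Suc n"] radius_nonneg[of n] radius_mono[of n "Suc n"]
      by (auto intro!: powr_mono2 power_mono simp: power_le_one)
    \<comment> \<open>The base tends to 0, where the limit rule for \<open>powr\<close> asks for a
      positive exponent and nonnegative bases.\<close>
    have "(\<lambda>n. (1 - (radius n)\<^sup>2) powr \<gamma>) \<longlonglongrightarrow> (1 - 1\<^sup>2) powr \<gamma>"
      using gamma_pos radius_less_1 radius_nonneg
      by (intro tendsto_powr' tendsto_diff tendsto_power tendsto_const radius_LIMSEQ)
        (auto simp: power_le_one less_imp_le)
    then show "(\<lambda>n. ?k n z) \<longlonglongrightarrow> (1 - (norm z)\<^sup>2) powr \<gamma>" for z :: "complex ^ 'n"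
      using tendsto_diff[OF tendsto_const, of "\<lambda>n. (1 - (radius n)\<^sup>2) powr \<gamma>" 0] by simp
  qed (simp add: sum_nonneg)
  then have "(\<lambda>n. ennreal (\<gamma> * ball_integral (\<gamma> - 1) (radius n) radial)) \<longlonglongrightarrow> weighted_integral \<gamma> energy"
    by (simp only: bergman_integration_by_parts[OF radius_nonneg radius_less_1 f_derivative eta_holomorphic]
        radial_def)
  from ennreal_tendsto_cmult[OF _ this, of "ennreal (1 / \<gamma>)"] show ?thesis
    using gamma_pos by (simp add: ennreal_mult'[symmetric])
qed

lemma inequality:
  "weighted_integral (\<gamma> - 1) (\<lambda>z. (cmod (f z))\<^sup>2) \<le> ennreal (1 / \<gamma>) * weighted_integral \<gamma> energy"
  by (rule LIMSEQ_le[OF sq_LIMSEQ radial_LIMSEQ])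
    (use ball_integral_excess_nonneg[OF radius_less_1] in
      \<open>auto intro!: ennreal_leI simp: ball_integral_radial[OF radius_less_1]\<close>)

lemma energy_finite: "weighted_integral \<gamma> energy < \<infinity>"
proof -
  have "weighted_integral \<gamma> energy =
      (\<integral>\<^sup>+z. (\<Sum>k\<in>UNIV. ennreal ((cmod (\<eta> k z))\<^sup>2 * (1 - (norm z)\<^sup>2) powr \<gamma>) * indicator (ball 0 1) z) \<partial>lborel)"
    unfolding weighted_integral_def
    by (intro nn_integral_cong) (simp add: sum_distrib_right[symmetric] sum_ennreal)
  also have "\<dots> = (\<Sum>k\<in>UNIV. weighted_integral \<gamma> (\<lambda>z. (cmod (\<eta> k z))\<^sup>2))"
    unfolding weighted_integral_def
    by (intro nn_integral_sum) (use weighted_borel_measurable[of "\<lambda>z. (cmod (\<eta> k z))\<^sup>2" \<gamma> for k] in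
        \<open>simp add: continuous continuous_intros\<close>)
  also have "\<dots> < \<infinity>"
    using form by (simp add: closed_bergman_form_def bergman_space_def)
  finally show ?thesis .
qed

text \<open>On the ball the base of the weight is at most 1, so exponent \<open>\<gamma>\<close> is
  dominated by \<open>\<gamma> - 1\<close>, and the inequality itself yields square
  integrability.\<close>

lemma f_in_primitives: "f \<in> bergman_primitives \<gamma> \<eta>"
proof -
  have "weighted_integral \<gamma> (\<lambda>z. (cmod (f z))\<^sup>2) \<le> weighted_integral (\<gamma> - 1) (\<lambda>z. (cmod (f z))\<^sup>2)"
    unfolding weighted_integral_def
  proof (rule nn_integral_mono)
    fix z :: "complex ^ 'n"
    have "(1 - (norm z)\<^sup>2) powr \<gamma> \<le> (1 - (norm z)\<^sup>2) powr (\<gamma> - 1)" if "norm z < 1"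
      using one_minus_norm_sq_pos[OF that] by (intro powr_mono') auto
    then show "ennreal ((cmod (f z))\<^sup>2 * (1 - (norm z)\<^sup>2) powr \<gamma>) * indicator (ball 0 1) z
        \<le> ennreal ((cmod (f z))\<^sup>2 * (1 - (norm z)\<^sup>2) powr (\<gamma> - 1)) * indicator (ball 0 1) z"
      by (auto simp: indicator_def intro!: ennreal_leI mult_left_mono)
  qed
  also note inequality
  also have "ennreal (1 / \<gamma>) * weighted_integral \<gamma> energy < \<infinity>"
    using energy_finite by (simp add: ennreal_mult_less_top)
  finally show ?thesis
    using f_holomorphic f_partial_deriv by (simp add: bergman_primitives_def bergman_space_def)
qed

text \<open>Another primitive is \<open>f + c\<close> on the ball, and the difference of the squared
  moduli has circle integral \<open>2 * pi * (cmod c)^2\<close>. Hence sharpness can be tested on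
  \<open>f\<close> alone.\<close>

lemma minimal:
  assumes g: "g \<in> bergman_primitives \<gamma> \<eta>"
  shows "weighted_integral (\<gamma> - 1) (\<lambda>z. (cmod (f z))\<^sup>2) \<le> weighted_integral (\<gamma> - 1) (\<lambda>z. (cmod (g z))\<^sup>2)"
proof -
  have "(g has_derivative (\<lambda>h. \<Sum>k\<in>UNIV. h $ k * \<eta> k z)) (at z)" if "z \<in> ball 0 1" for z
    using g holomorphic_Cn_has_derivative[of g "ball 0 1" z] that
    by (simp add: bergman_primitives_def bergman_space_def)
  from zero_derivative_imp_constant_on_ball[OF f_derivative this]
  obtain c where c: "\<And>z. z \<in> ball 0 1 \<Longrightarrow> g z = f z + c" by blast
  let ?g = "\<lambda>z. (cmod (f z + c))\<^sup>2"
  have cont: "continuous_on (ball 0 1) ?g" by (intro continuous_intros continuous)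
  have cont': "continuous_on (ball 0 1) (\<lambda>z. ?g z - (cmod (f z))\<^sup>2)" by (intro continuous_intros continuous)
  have "weighted_integral (\<gamma> - 1) (\<lambda>z. (cmod (g z))\<^sup>2) = weighted_integral (\<gamma> - 1) ?g"
    unfolding weighted_integral_def by (intro nn_integral_cong) (simp add: c indicator_def)
  moreover have "ball_integral \<alpha> (radius n) (\<lambda>z. (cmod (f z))\<^sup>2) \<le> ball_integral \<alpha> (radius n) ?g" for \<alpha> n
    using ball_integral_nonneg_if_circle_integral_nonneg[OF cont' radius_less_1[of n]]
      ball_integral_diff[OF cont continuous_sq radius_less_1[of n]]
    by (simp add: circle_integral_add_const[OF f_holomorphic f_0])
  then have "weighted_integral (\<gamma> - 1) (\<lambda>z. (cmod (f z))\<^sup>2) \<le> weighted_integral (\<gamma> - 1) ?g"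
    by (intro LIMSEQ_le[OF sq_LIMSEQ ball_integral_LIMSEQ[OF cont]]) (auto intro: ennreal_leI)
  ultimately show ?thesis by simp
qed

text \<open>A nonzero circle integral produces a positive gap \<delta> on some ball containing
  \<open>z\<close>. The gap persists for all larger radii and survives in the limit, contradicting
  equality since the right-hand side is finite.\<close>

lemma equality_imp_circle_integral_excess_eq_0:
  assumes eq: "weighted_integral (\<gamma> - 1) (\<lambda>z. (cmod (f z))\<^sup>2) = ennreal (1 / \<gamma>) * weighted_integral \<gamma> energy"
    and z: "z \<in> ball 0 1"
  shows "circle_integral excess z = 0"
proof (rule ccontr)
  assume nz: "circle_integral excess z \<noteq> 0"
  note cont = continuous_on_circle_integral[OF continuous_excess]
  have "\<forall>\<^sub>F n in sequentially. norm z < radius n"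
    using z by (intro eventually_less_radius) auto
  then obtain m where mz: "norm z < radius m"
    unfolding eventually_sequentially by blast
  then have m: "0 < radius m" "norm z < radius m"
    using norm_ge_zero[of z] by linarith+
  define \<delta> where "\<delta> = ball_integral (\<gamma> - 1) (radius m) excess"
  have "ball_integral (\<gamma> - 1) (radius m) (circle_integral excess) \<noteq> 0"
    using ball_integral_eq_0_imp[OF cont circle_integral_excess(1) m(1) radius_less_1, of "\<gamma> - 1" z] m(2) nz
    by auto
  then have "\<delta> \<noteq> 0"
    by (simp add: \<delta>_def ball_integral_circle_integral[OF continuous_excess radius_less_1])
  then have \<delta>: "0 < \<delta>"
    using ball_integral_excess_nonneg[OF radius_less_1] by (simp add: \<delta>_def less_le)
  \<comment> \<open>Monotonicity in the radius holds for the averaged, nonnegative function and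
    transfers to \<open>excess\<close> through the common factor \<open>2 * pi\<close>.\<close>
  have "\<delta> \<le> ball_integral (\<gamma> - 1) (radius n) excess" if "m \<le> n" for n
    using ball_integral_mono_radius[OF cont circle_integral_excess(1) radius_mono[OF that] radius_less_1, of "\<gamma> - 1"]
    by (simp add: \<delta>_def ball_integral_circle_integral[OF continuous_excess radius_less_1])
  moreover have "0 \<le> ball_integral (\<gamma> - 1) (radius n) (\<lambda>z. (cmod (f z))\<^sup>2)" for n
    by (rule ball_integral_nonneg) simp
  ultimately have "\<forall>n\<ge>m. ennreal (ball_integral (\<gamma> - 1) (radius n) (\<lambda>z. (cmod (f z))\<^sup>2)) + ennreal \<delta>
      \<le> ennreal (ball_integral (\<gamma> - 1) (radius n) radial)"
    using \<delta> by (simp add: ball_integral_radial[OF radius_less_1] ennreal_leI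
        flip: ennreal_plus)
  then have "weighted_integral (\<gamma> - 1) (\<lambda>z. (cmod (f z))\<^sup>2) + ennreal \<delta> \<le> ennreal (1 / \<gamma>) * weighted_integral \<gamma> energy"
    by (intro LIMSEQ_le[OF tendsto_add[OF sq_LIMSEQ tendsto_const] radial_LIMSEQ]) auto
  moreover have "ennreal (1 / \<gamma>) * weighted_integral \<gamma> energy \<noteq> top"
    using energy_finite by (auto simp: ennreal_mult_eq_top_iff)
  ultimately show False
    using \<delta> eq ennreal_add_left_cancel_le[of _ "ennreal \<delta>" 0] by simp
qed

text \<open>Equality makes \<open>f\<close> homogeneous of degree 1; differentiating, each \<eta> k
  is constant along rays and by continuity equal to its value at 0. Conversely, constant
  coefficients make \<open>f\<close> a linear form, for which \<open>radial\<close> equals the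
  squared modulus pointwise.\<close>

lemma equality_iff:
  "weighted_integral (\<gamma> - 1) (\<lambda>z. (cmod (f z))\<^sup>2) = ennreal (1 / \<gamma>) * weighted_integral \<gamma> energy
     \<longleftrightarrow> (\<forall>k. \<eta> k constant_on ball 0 1)"
proof
  assume eq: "weighted_integral (\<gamma> - 1) (\<lambda>z. (cmod (f z))\<^sup>2) = ennreal (1 / \<gamma>) * weighted_integral \<gamma> energy"
  have scale_f: "f (t *\<^sub>R z) = t *\<^sub>R f z" if "z \<in> ball 0 1" "0 < t" "t \<le> 1" for t z
    using circle_integral_excess(2)[OF that(1) equality_imp_circle_integral_excess_eq_0[OF eq that(1)], of "of_real t"] that
    by (simp add: scaleR_conv_of_real[where 'a = complex] vector_scalar_mult_def scaleR_vec_def)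
  have scale_eta: "\<eta> k (t *\<^sub>R z) = \<eta> k z" if z: "z \<in> ball 0 1" and t: "0 < t" "t \<le> 1" for t z k
  proof -
    have "t * norm z \<le> 1 * norm z" using t by (intro mult_right_mono) auto
    then have tz: "t *\<^sub>R z \<in> ball 0 1" using z t by simp
    have "((\<lambda>x. t *\<^sub>R x) has_derivative (\<lambda>h. t *\<^sub>R h)) (at z)"
      by (auto intro!: derivative_eq_intros)
    from has_derivative_compose[OF this f_derivative[OF tz]]
    have "((\<lambda>x. f (t *\<^sub>R x)) has_derivative (\<lambda>h. \<Sum>k\<in>UNIV. (t *\<^sub>R h) $ k * \<eta> k (t *\<^sub>R z))) (at z)" .
    then have 1: "((\<lambda>x. t *\<^sub>R f x) has_derivative (\<lambda>h. \<Sum>k\<in>UNIV. (t *\<^sub>R h) $ k * \<eta> k (t *\<^sub>R z))) (at z)"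
      by (rule has_derivative_transform_within_open[OF _ open_ball z]) (use scale_f t in auto)
    have "((\<lambda>x. t *\<^sub>R f x) has_derivative (\<lambda>h. t *\<^sub>R (\<Sum>k\<in>UNIV. h $ k * \<eta> k z))) (at z)"
      by (intro has_derivative_scaleR_right f_derivative z)
    \<comment> \<open>The direction \<open>axis k 1\<close> isolates the \<open>k\<close>-th
      coefficient; the factor \<open>t\<close> on both sides cancels.\<close>
    from fun_cong[OF has_derivative_unique[OF 1 this], of "axis k 1"] show ?thesis
      using t by (simp add: axis_def if_distribR if_distrib[of "\<lambda>x. x * _"] if_distrib[of "\<lambda>x. t *\<^sub>R x"] cong: if_cong)
  qed
  show "\<forall>k. \<eta> k constant_on ball 0 1"
  proof
    fix k
    have "\<eta> k z = \<eta> k 0" if z: "z \<in> ball 0 1" for z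
    proof -
      have "(\<lambda>n. inverse (real (Suc n)) *\<^sub>R z) \<longlonglongrightarrow> 0 *\<^sub>R z"
        by (intro tendsto_scaleR LIMSEQ_inverse_real_of_nat tendsto_const)
      moreover have "isCont (\<eta> k) 0"
        using continuous(2)[of k] by (simp add: continuous_on_eq_continuous_at)
      ultimately have "(\<lambda>n. \<eta> k (inverse (real (Suc n)) *\<^sub>R z)) \<longlonglongrightarrow> \<eta> k 0"
        by (auto intro!: isCont_tendsto_compose[of 0 "\<eta> k"])
      moreover have "\<eta> k (inverse (real (Suc n)) *\<^sub>R z) = \<eta> k z" for n
        by (rule scale_eta[OF z]) (auto simp: field_simps)
      ultimately show ?thesis by (simp add: LIMSEQ_const_iff)
    qed
    then show "\<eta> k constant_on ball 0 1" unfolding constant_on_def by blast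
  qed
next
  assume "\<forall>k. \<eta> k constant_on ball 0 1"
  then obtain c where c: "\<And>k z. z \<in> ball 0 1 \<Longrightarrow> \<eta> k z = c k"
    unfolding constant_on_def by metis
  \<comment> \<open>The linear form with coefficients \<open>c\<close> is also a primitive and
    vanishes at 0, so it agrees with \<open>f\<close> on the ball.\<close>
  have "((\<lambda>z. \<Sum>k\<in>UNIV. z $ k * c k) has_derivative (\<lambda>h. \<Sum>k\<in>UNIV. h $ k * \<eta> k z)) (at z)" if "z \<in> ball 0 1" for z
    unfolding c[OF that]
    by (intro has_derivative_sum has_derivative_mult_left bounded_linear_imp_has_derivative bounded_linear_vec_nth)
  from zero_derivative_imp_constant_on_ball[OF f_derivative this]
  obtain d where d: "\<And>z. z \<in> ball 0 1 \<Longrightarrow> (\<Sum>k\<in>UNIV. z $ k * c k) = f z + d" by blast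
  from d[of 0] have "d = 0" by (simp add: f_0)
  with c d have "radial z = (cmod (f z))\<^sup>2" if "z \<in> ball 0 1" for z
    using that unfolding radial_def by (simp add: cmod_power2) (simp add: power2_eq_square)
  then have "ball_integral (\<gamma> - 1) (radius n) radial = ball_integral (\<gamma> - 1) (radius n) (\<lambda>z. (cmod (f z))\<^sup>2)" for n
    unfolding ball_integral_def using radius_less_1[of n]
    by (intro Bochner_Integration.integral_cong) (auto simp: indicator_def)
  with sq_LIMSEQ radial_LIMSEQ
  show "weighted_integral (\<gamma> - 1) (\<lambda>z. (cmod (f z))\<^sup>2) = ennreal (1 / \<gamma>) * weighted_integral \<gamma> energy"
    by (auto intro: LIMSEQ_unique)
qed

end

section \<open>Existence of the primitive and sharpness of the constant\<close>

lemma bergman_primitive_exists: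
  fixes \<eta> :: "'n::finite \<Rightarrow> complex ^ 'n \<Rightarrow> complex"
  assumes "0 < \<gamma>" and form: "closed_bergman_form \<gamma> \<eta>"
  obtains f where "bergman_primitive \<gamma> \<eta> f"
proof (rule that)
  let ?f = "\<lambda>z. integral {0..1} (\<lambda>t::real. \<Sum>k\<in>UNIV. z $ k * \<eta> k (t *\<^sub>R z))"
  show "bergman_primitive \<gamma> \<eta> ?f"
  proof
    show "(?f has_derivative (\<lambda>h. \<Sum>k\<in>UNIV. h $ k * \<eta> k z)) (at z)" if "z \<in> ball 0 1" for z
      using form that
      by (intro closed_form_primitive) (auto simp: closed_bergman_form_def bergman_space_def)
  qed (use assms in auto)
qed

text \<open>The witness for sharpness. Its energy is finite because the weight is at most 1 on a
  ball of finite measure, and nonzero because the weight is at least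
  \<open>(3 / 4) powr \<gamma>\<close> on the ball of radius 1/2, where
  \<open>3 / 4 = 1 - (1 / 2)^2\<close>.\<close>

lemma constant_form:
  assumes \<gamma>: "0 < \<gamma>"
  defines "\<eta> \<equiv> \<lambda>(k :: 'n::finite) (z :: complex ^ 'n). 1 :: complex"
  shows "closed_bergman_form \<gamma> \<eta>"
    and "weighted_integral \<gamma> (\<lambda>z. \<Sum>k\<in>UNIV. (cmod (\<eta> k z))\<^sup>2) \<noteq> 0"
proof -
  have "weighted_integral \<gamma> (\<lambda>z :: complex ^ 'n. 1) \<le> (\<integral>\<^sup>+z. indicator (ball (0 :: complex ^ 'n) 1) z \<partial>lborel)"
    unfolding weighted_integral_def
  proof (rule nn_integral_mono)
    fix z :: "complex ^ 'n"
    have "(1 - (norm z)\<^sup>2) powr \<gamma> \<le> 1" if "norm z < 1"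
      using one_minus_norm_sq_pos[OF that] \<gamma> by (intro powr_le1) auto
    then show "ennreal (1 * (1 - (norm z)\<^sup>2) powr \<gamma>) * indicator (ball 0 1) z \<le> indicator (ball 0 1) z"
      by (auto simp: indicator_def)
  qed
  also have "\<dots> < \<infinity>"
    using emeasure_lborel_ball_finite[of "0 :: complex ^ 'n" 1] by simp
  finally have "weighted_integral \<gamma> (\<lambda>z :: complex ^ 'n. 1) < \<infinity>" .
  moreover have "holomorphic_Cn (\<lambda>z :: complex ^ 'n. 1) (ball 0 1)"
    unfolding holomorphic_Cn_def by (auto intro!: exI[of _ "\<lambda>h. 0"])
  ultimately show "closed_bergman_form \<gamma> \<eta>"
    by (simp add: \<eta>_def closed_bergman_form_def bergman_space_def partial_deriv_def)
  let ?b = "ball (0 :: complex ^ 'n) (1 / 2)"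
  have "ennreal ((3 / 4) powr \<gamma>) * emeasure lborel ?b = (\<integral>\<^sup>+z. ennreal ((3 / 4) powr \<gamma>) * indicator ?b z \<partial>lborel)"
    by (rule nn_integral_cmult_indicator[symmetric]) simp
  also have "\<dots> \<le> weighted_integral \<gamma> (\<lambda>z. \<Sum>k\<in>UNIV. (cmod (\<eta> k z))\<^sup>2)"
    unfolding weighted_integral_def
  proof (rule nn_integral_mono)
    fix z :: "complex ^ 'n"
    have "(3 / 4) powr \<gamma> \<le> real CARD('n) * (1 - (norm z)\<^sup>2) powr \<gamma>" if "norm z < 1 / 2"
    proof -
      have "(norm z)\<^sup>2 \<le> (1 / 2)\<^sup>2" using that by (intro power_mono) auto
      then have "(3 / 4) powr \<gamma> \<le> (1 - (norm z)\<^sup>2) powr \<gamma>"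
        using \<gamma> by (intro powr_mono2) (auto simp: power2_eq_square)
      also have "\<dots> \<le> real CARD('n) * (1 - (norm z)\<^sup>2) powr \<gamma>"
        using mult_right_mono[of 1 "real CARD('n)" "(1 - (norm z)\<^sup>2) powr \<gamma>"] by (simp add: Suc_le_eq)
      finally show ?thesis .
    qed
    then show "ennreal ((3 / 4) powr \<gamma>) * indicator ?b z
        \<le> ennreal ((\<Sum>k\<in>UNIV. (cmod (\<eta> k z))\<^sup>2) * (1 - (norm z)\<^sup>2) powr \<gamma>) * indicator (ball 0 1) z"
      by (auto simp: indicator_def \<eta>_def intro!: ennreal_leI)
  qed
  finally show "weighted_integral \<gamma> (\<lambda>z. \<Sum>k\<in>UNIV. (cmod (\<eta> k z))\<^sup>2) \<noteq> 0"
    using content_ball_pos[of "1 / 2" "0 :: complex ^ 'n"] by (auto simp: measure_def)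
qed

text \<open>The equality clause concerns a primitive of least weighted norm, since adding a constant
  to a primitive preserves the form but can change the left-hand side. Sharpness means that every
  smaller constant fails for all primitives of some form.\<close>

theorem theorem1p2:
  fixes \<gamma> :: real
  assumes "\<gamma> > 0"
  shows
    "(\<forall>\<eta> :: 'n::finite \<Rightarrow> complex ^ 'n \<Rightarrow> complex. closed_bergman_form \<gamma> \<eta> \<longrightarrow>
        (\<exists>f \<in> bergman_primitives \<gamma> \<eta>.
           weighted_integral (\<gamma> - 1) (\<lambda>z. (cmod (f z))\<^sup>2)
             \<le> ennreal (1 / \<gamma>) * weighted_integral \<gamma> (\<lambda>z. \<Sum>k\<in>UNIV. (cmod (\<eta> k z))\<^sup>2)
           \<and> (\<forall>g \<in> bergman_primitives \<gamma> \<eta>.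
                weighted_integral (\<gamma> - 1) (\<lambda>z. (cmod (f z))\<^sup>2)
                  \<le> weighted_integral (\<gamma> - 1) (\<lambda>z. (cmod (g z))\<^sup>2))
           \<and> (weighted_integral (\<gamma> - 1) (\<lambda>z. (cmod (f z))\<^sup>2)
                = ennreal (1 / \<gamma>) * weighted_integral \<gamma> (\<lambda>z. \<Sum>k\<in>UNIV. (cmod (\<eta> k z))\<^sup>2)
              \<longleftrightarrow> (\<forall>k. \<eta> k constant_on ball 0 1))))
     \<and> (\<forall>C < 1 / \<gamma>. \<exists>\<eta> :: 'n \<Rightarrow> complex ^ 'n \<Rightarrow> complex. closed_bergman_form \<gamma> \<eta> \<and>
          \<not> (\<exists>f \<in> bergman_primitives \<gamma> \<eta>.
               weighted_integral (\<gamma> - 1) (\<lambda>z. (cmod (f z))\<^sup>2)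
                 \<le> ennreal C * weighted_integral \<gamma> (\<lambda>z. \<Sum>k\<in>UNIV. (cmod (\<eta> k z))\<^sup>2)))"
proof (intro conjI allI impI)
  fix \<eta> :: "'n \<Rightarrow> complex ^ 'n \<Rightarrow> complex"
  assume "closed_bergman_form \<gamma> \<eta>"
  then obtain f where "bergman_primitive \<gamma> \<eta> f"
    by (rule bergman_primitive_exists[OF assms])
  then interpret bergman_primitive \<gamma> \<eta> f .
  show "\<exists>f \<in> bergman_primitives \<gamma> \<eta>.
           weighted_integral (\<gamma> - 1) (\<lambda>z. (cmod (f z))\<^sup>2)
             \<le> ennreal (1 / \<gamma>) * weighted_integral \<gamma> (\<lambda>z. \<Sum>k\<in>UNIV. (cmod (\<eta> k z))\<^sup>2)
           \<and> (\<forall>g \<in> bergman_primitives \<gamma> \<eta>.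
                weighted_integral (\<gamma> - 1) (\<lambda>z. (cmod (f z))\<^sup>2)
                  \<le> weighted_integral (\<gamma> - 1) (\<lambda>z. (cmod (g z))\<^sup>2))
           \<and> (weighted_integral (\<gamma> - 1) (\<lambda>z. (cmod (f z))\<^sup>2)
                = ennreal (1 / \<gamma>) * weighted_integral \<gamma> (\<lambda>z. \<Sum>k\<in>UNIV. (cmod (\<eta> k z))\<^sup>2)
              \<longleftrightarrow> (\<forall>k. \<eta> k constant_on ball 0 1))"
    using f_in_primitives inequality minimal equality_iff by blast
next
  fix C :: real assume C: "C < 1 / \<gamma>"
  let ?\<eta> = "\<lambda>(k :: 'n) (z :: complex ^ 'n). 1 :: complex"
  let ?Q = "weighted_integral \<gamma> (\<lambda>z :: complex ^ 'n. \<Sum>k\<in>(UNIV :: 'n set). (cmod (?\<eta> k z))\<^sup>2)"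
  note const = constant_form[OF assms, where 'n = 'n]
  obtain f where "bergman_primitive \<gamma> ?\<eta> f"
    by (rule bergman_primitive_exists[OF assms const(1)])
  then interpret bergman_primitive \<gamma> ?\<eta> f .
  have "\<not> weighted_integral (\<gamma> - 1) (\<lambda>z. (cmod (g z))\<^sup>2) \<le> ennreal C * ?Q"
    if g: "g \<in> bergman_primitives \<gamma> ?\<eta>" for g
  proof
    assume "weighted_integral (\<gamma> - 1) (\<lambda>z. (cmod (g z))\<^sup>2) \<le> ennreal C * ?Q"
    moreover have "weighted_integral (\<gamma> - 1) (\<lambda>z. (cmod (f z))\<^sup>2) = ennreal (1 / \<gamma>) * ?Q"
      using equality_iff by (auto simp: constant_on_def)
    ultimately have "ennreal (1 / \<gamma>) * ?Q \<le> ennreal C * ?Q"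
      using minimal[OF g] by simp
    \<comment> \<open>Strictness needs \<open>?Q\<close> to be both nonzero and finite; a negative
      \<open>C\<close> is covered, as \<open>ennreal C\<close> is then 0.\<close>
    moreover have "ennreal C * ?Q < ennreal (1 / \<gamma>) * ?Q"
      using const(2) energy_finite C assms
      by (intro ennreal_mult_strict_right_mono) (auto simp: ennreal_lessI zero_less_iff_neq_zero)
    ultimately show False by simp
  qed
  with const(1) show "\<exists>\<eta> :: 'n \<Rightarrow> complex ^ 'n \<Rightarrow> complex. closed_bergman_form \<gamma> \<eta> \<and>
          \<not> (\<exists>f \<in> bergman_primitives \<gamma> \<eta>.
               weighted_integral (\<gamma> - 1) (\<lambda>z. (cmod (f z))\<^sup>2)
                 \<le> ennreal C * weighted_integral \<gamma> (\<lambda>z. \<Sum>k\<in>UNIV. (cmod (\<eta> k z))\<^sup>2))"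
    by blast
qed

end
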